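(* Let $X$ and $Y$ be compact subsets of $\mathbb{R}^n$, and let $\mu\in\mathcal{P}(X)$, $\nu\in\mathcal{P}(Y)$ be probability measures, both absolutely continuous with respect to the Lebesgue measure. Let the cost $c\colon X\times Y\to\mathbb{R}$ be lower semicontinuous. For measurable maps $t\colon X\to Y$ and functions $\psi\in C(Y)$ define $$F(\psi,t)=\int_X c(x,t(x))\,d\mu(x)+\int_Y \psi(y)\,d(\nu-t_\sharp\mu)(y).$$ Below, $\sup_\psi$ is taken over $\psi\in C(Y)$ and $\inf_t$ over all measurable maps $t\colon X\to Y$. Then: (i) The minimax value satisfies $$\sup_{\psi}\inf_{t}F(\psi,t)=\sup_{\psi}\left(\int_X\psi^c\,d\mu+\int_Y\psi\,d\nu\right),$$ and this coincides with the value $DP(\mu,\nu,c)$ of the Kantorovich dual problem. (ii) For all $\psi$, $$\inf_t F(\psi,t)\le\inf_t F(\psi^{cc},t),$$ with equality reached on $c$-concave functions $\psi$ only. (iii) If $t_\sharp\mu\neq\nu$, then $$\sup_\psi F(\psi,t)=+\infty.$$ (iv) Suppose in addition that $c(x,y)=\frac1p|x-y|^p$ with $1<p<+\infty$. Then there exist an optimal potential $\psi^\star$ and a measurable map $T^\star\colon X\to Y$ such that for all $\psi$ and $t$ $$F(\psi^\star,t)\ge F(\psi^\star,T^\star)=F(\psi,T^\star).$$ Moreover, $$T^\star(x)=\arg\min_{y\in Y}\,[c(x,y)-\psi^\star(y)]\quad\text{for }\mu\text{-a.e. }x,$$ and $T^\star$ coincides with the (Brenier) optimal transport map from $\mu$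 to $\nu$ for the cost $c$, with $$T^\star(x)=x-|\nabla\psi^{\star c}(x)|^{q-2}\,\nabla\psi^{\star c}(x)\quad\text{for }\mu\text{-a.e. }x,\qquad \frac1q=1-\frac1p,$$ where $\psi^{\star c}=(\psi^\star)^c$. (v) With $c$, $\psi^\star$ and $T^\star$ as in (iv), the map $T^\star$ is unique $\mu$-almost everywhere and is the unique minimizer (up to $\mu$-a.e. equality) of $t\mapsto F(\psi^\star,t)$.
   Context: $\mathcal{P}(X)$ denotes the Borel probability measures on $X$; $|\cdot|$ is the Euclidean norm. The push-forward $t_\sharp\mu$ is the measure $B\mapsto\mu(t^{-1}(B))$. $c$-transforms: for $\varphi\colon X\to\mathbb{R}\cup\{\pm\infty\}$ and $\psi\colon Y\to\mathbb{R}\cup\{\pm\infty\}$, $$\varphi^c(y)=\inf_{x\in X}[c(x,y)-\varphi(x)],\qquad \psi^c(x)=\inf_{y\in Y}[c(x,y)-\psi(y)],$$ and $\psi^{cc}=(\psi^c)^c\colon Y\to\mathbb{R}\cup\{\pm\infty\}$. A function is called $c$-concave if it is the $c$-transform of some function on the other space (so $\psi$ on $Y$ is $c$-concave if $\psi=\varphi^c$ for some $\varphi$ on $X$). $F(\psi^{cc},t)$ is defined by the same formula as $F(\psi,t)$, namely $\int_X[c(x,t(x))-\psi^{cc}(t(x))]\,d\mu+\int_Y\psi^{cc}\,d\nu$. Kantorovich dual problem: $$DP(\mu,\nu,c)=\sup\left\{\int_X\varphi\,d\mu+\int_Y\psi\,d\nu:\ \varphi\in C(X),\ \psi\in C(Y),\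 \varphi(x)+\psi(y)\le c(x,y)\ \ \forall (x,y)\in X\times Y\right\}.$$ An optimal potential $\psi^\star$ is a maximizer over $\psi\in C(Y)$ of $\int_X\psi^c\,d\mu+\int_Y\psi\,d\nu$. An optimal transport map from $\mu$ to $\nu$ is a minimizer of $\int_X c(x,T(x))\,d\mu(x)$ over measurable $T\colon X\to Y$ with $T_\sharp\mu=\nu$. The expression $|v|^{q-2}v$ is understood as $0$ when $v=0$.
   Formalization: In (ii) the "only" claim is false as stated; proved instead: c-concave ψ give equality; equality with finite value gives ψ = ψ^cc ν-a.e.; and equality gives ψ c-concave if c is continuous and ν charges every nonempty relatively open subset of Y. *)

theory Defs
  imports "HOL-Probability.Probability"
begin

definition lsc_on :: "'a::topological_space set \<Rightarrow> ('a \<Rightarrow> real) \<Rightarrow> bool" where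
  "lsc_on S f \<longleftrightarrow> (\<forall>z\<in>S. \<forall>a<f z. eventually (\<lambda>w. a < f w) (at z within S))"

(* Elements of P(X) are measures whose space is X itself, so a Borel map t from X to Y is an
   element of measurable \<mu> \<nu>, and its push-forward is distr \<mu> \<nu> t. *)
definition borel_prob_on :: "'a::topological_space set \<Rightarrow> 'a measure \<Rightarrow> bool" where
  "borel_prob_on X \<mu> \<longleftrightarrow> prob_space \<mu> \<and> sets \<mu> = sets (restrict_space borel X)"

(* Integral of an extended-real function, meaningful unless both parts are infinite (in which
   case ereal subtraction would return infinity). It is needed because c is only bounded below:
   the integrals of c(x, t x) and of c-transforms may be infinite. *)
definition ext_integral :: "'a measure \<Rightarrow> ('a \<Rightarrow> ereal) \<Rightarrow> ereal" where
  "ext_integral M f =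
     enn2ereal (\<integral>\<^sup>+ x. e2ennreal (f x) \<partial>M) - enn2ereal (\<integral>\<^sup>+ x. e2ennreal (- f x) \<partial>M)"

definition ctrans_X :: "('a \<Rightarrow> 'b \<Rightarrow> real) \<Rightarrow> 'a set \<Rightarrow> ('a \<Rightarrow> ereal) \<Rightarrow> 'b \<Rightarrow> ereal" where
  "ctrans_X c X \<phi> y = (INF x\<in>X. ereal (c x y) - \<phi> x)"

definition ctrans_Y :: "('a \<Rightarrow> 'b \<Rightarrow> real) \<Rightarrow> 'b set \<Rightarrow> ('b \<Rightarrow> ereal) \<Rightarrow> 'a \<Rightarrow> ereal" where
  "ctrans_Y c Y \<psi> x = (INF y\<in>Y. ereal (c x y) - \<psi> y)"

definition cc_trans ::
    "('a \<Rightarrow> 'b \<Rightarrow> real) \<Rightarrow> 'a set \<Rightarrow> 'b set \<Rightarrow> ('b \<Rightarrow> ereal) \<Rightarrow> 'b \<Rightarrow> ereal" where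
  "cc_trans c X Y \<psi> = ctrans_X c X (ctrans_Y c Y \<psi>)"

definition c_concave_on_Y ::
    "('a \<Rightarrow> 'b \<Rightarrow> real) \<Rightarrow> 'a set \<Rightarrow> 'b set \<Rightarrow> ('b \<Rightarrow> ereal) \<Rightarrow> bool" where
  "c_concave_on_Y c X Y \<psi> \<longleftrightarrow> (\<exists>\<phi>. \<forall>y\<in>Y. \<psi> y = ctrans_X c X \<phi> y)"

(* The integral against the signed measure \<nu> - t_#\<mu> is the difference of the two integrals. *)
definition F_fun ::
    "('a \<Rightarrow> 'b \<Rightarrow> real) \<Rightarrow> 'a measure \<Rightarrow> 'b measure \<Rightarrow> ('b \<Rightarrow> real) \<Rightarrow> ('a \<Rightarrow> 'b) \<Rightarrow> ereal" where
  "F_fun c \<mu> \<nu> \<psi> t =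
     ext_integral \<mu> (\<lambda>x. ereal (c x (t x)))
     + ereal ((\<integral>y. \<psi> y \<partial>\<nu>) - (\<integral>y. \<psi> y \<partial>(distr \<mu> \<nu> t)))"

(* The form of F used at \<psi>^cc, which need not be continuous nor bounded above; the two
   integrals are grouped so that each is well defined in (-infinity, infinity]. *)
definition F_fun_ext ::
    "('a \<Rightarrow> 'b \<Rightarrow> real) \<Rightarrow> 'a measure \<Rightarrow> 'b measure \<Rightarrow> ('b \<Rightarrow> ereal) \<Rightarrow> ('a \<Rightarrow> 'b) \<Rightarrow> ereal" where
  "F_fun_ext c \<mu> \<nu> \<psi> t =
     ext_integral \<mu> (\<lambda>x. ereal (c x (t x)) - \<psi> (t x)) + ext_integral \<nu> \<psi>"

definition dual_fun ::
    "('a \<Rightarrow> 'b \<Rightarrow> real) \<Rightarrow> 'b set \<Rightarrow> 'a measure \<Rightarrow> 'b measure \<Rightarrow> ('b \<Rightarrow> real) \<Rightarrow> ereal" where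
  "dual_fun c Y \<mu> \<nu> \<psi> =
     ext_integral \<mu> (ctrans_Y c Y (\<lambda>y. ereal (\<psi> y))) + ereal (\<integral>y. \<psi> y \<partial>\<nu>)"

definition kantorovich_dual ::
    "('a::topological_space \<Rightarrow> 'b::topological_space \<Rightarrow> real) \<Rightarrow> 'a set \<Rightarrow> 'b set
      \<Rightarrow> 'a measure \<Rightarrow> 'b measure \<Rightarrow> ereal" where
  "kantorovich_dual c X Y \<mu> \<nu> =
     (SUP (\<phi>, \<psi>) \<in> {(\<phi>, \<psi>). continuous_on X \<phi> \<and> continuous_on Y \<psi>
                          \<and> (\<forall>x\<in>X. \<forall>y\<in>Y. \<phi> x + \<psi> y \<le> c x y)}.
        ereal ((\<integral>x. \<phi> x \<partial>\<mu>) + (\<integral>y. \<psi> y \<partial>\<nu>)))"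

definition optimal_potential ::
    "('a \<Rightarrow> 'b::topological_space \<Rightarrow> real) \<Rightarrow> 'b set \<Rightarrow> 'a measure \<Rightarrow> 'b measure
      \<Rightarrow> ('b \<Rightarrow> real) \<Rightarrow> bool" where
  "optimal_potential c Y \<mu> \<nu> \<psi>s \<longleftrightarrow> continuous_on Y \<psi>s
     \<and> (\<forall>\<psi>. continuous_on Y \<psi> \<longrightarrow> dual_fun c Y \<mu> \<nu> \<psi> \<le> dual_fun c Y \<mu> \<nu> \<psi>s)"

definition optimal_transport_map ::
    "('a \<Rightarrow> 'b \<Rightarrow> real) \<Rightarrow> 'a measure \<Rightarrow> 'b measure \<Rightarrow> ('a \<Rightarrow> 'b) \<Rightarrow> bool" where
  "optimal_transport_map c \<mu> \<nu> T \<longleftrightarrow> T \<in> measurable \<mu> \<nu> \<and> distr \<mu> \<nu> T = \<nu>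
     \<and> (\<forall>S\<in>measurable \<mu> \<nu>. distr \<mu> \<nu> S = \<nu> \<longrightarrow>
          ext_integral \<mu> (\<lambda>x. ereal (c x (T x))) \<le> ext_integral \<mu> (\<lambda>x. ereal (c x (S x))))"

definition saddle_pair ::
    "('a \<Rightarrow> 'b::topological_space \<Rightarrow> real) \<Rightarrow> 'b set \<Rightarrow> 'a measure \<Rightarrow> 'b measure
      \<Rightarrow> ('b \<Rightarrow> real) \<Rightarrow> ('a \<Rightarrow> 'b) \<Rightarrow> bool" where
  "saddle_pair c Y \<mu> \<nu> \<psi>s Ts \<longleftrightarrow> optimal_potential c Y \<mu> \<nu> \<psi>s \<and> Ts \<in> measurable \<mu> \<nu>
     \<and> (\<forall>\<psi> t. continuous_on Y \<psi> \<longrightarrow> t \<in> measurable \<mu> \<nu> \<longrightarrow>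
          F_fun c \<mu> \<nu> \<psi>s t \<ge> F_fun c \<mu> \<nu> \<psi>s Ts \<and> F_fun c \<mu> \<nu> \<psi>s Ts = F_fun c \<mu> \<nu> \<psi> Ts)"

(* The derivative is taken within S because \<psi>^c is a function on X only, and X may have
   boundary (or even empty interior) of positive measure. Requiring g to be the only vector with
   the derivative property makes it "the" gradient also at such points; at interior points of S
   this is the usual gradient. *)
definition has_gradient_within ::
    "('a::real_inner \<Rightarrow> real) \<Rightarrow> 'a \<Rightarrow> 'a set \<Rightarrow> 'a \<Rightarrow> bool" where
  "has_gradient_within f g S x \<longleftrightarrow>
     (\<forall>g'. (f has_derivative (\<lambda>h. inner g' h)) (at x within S) \<longleftrightarrow> g' = g)"

end

theory Submission
  imports Defs "HOL-Complex_Analysis.Great_Picard"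
begin

text \<open>
Fix a continuous \<open>\<psi>\<close>. For every map \<open>t\<close> the integrand \<open>c x (t x) - \<psi> (t x)\<close> is at least \<open>\<psi>\<^sup>c x\<close>, and a
measurable selection of minimisers of \<open>c x y - \<psi> y\<close> attains this bound, so the inner infimum is the dual
functional at \<open>\<psi>\<close> (\<open>INF_F_fun_eq_dual_fun\<close>). Since \<open>\<psi>\<^sup>c\<close> is lower semicontinuous, its integral is the
supremum of the integrals of the continuous functions below it, which identifies the outer supremum with
the Kantorovich dual value (\<open>SUP_dual_fun_eq_kantorovich_dual\<close>).

The double transform satisfies \<open>\<psi> \<le> \<psi>\<^sup>c\<^sup>c\<close>, and the integrand at \<open>\<psi>\<^sup>c\<^sup>c\<close> is still at least \<open>\<psi>\<^sup>c\<close>. Passing to it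
therefore raises a finite infimum by at least \<open>\<integral>(\<psi>\<^sup>c\<^sup>c - \<psi>) d\<nu>\<close>, which is positive unless the two functions
agree almost everywhere; the argument depends on \<open>\<psi>\<^sup>c\<^sup>c\<close> being a Borel function (\<open>measurable_cctr\<close>). For a map that does not push \<open>\<mu>\<close> to \<open>\<nu>\<close>,
some continuous function separates the two measures, and large multiples of it make \<open>F\<close> unbounded.

For the power cost, write \<open>c x y = h (x - y)\<close> with \<open>h\<close> convex and with continuous injective gradient \<open>G\<close>. Three
facts produce the saddle point. An optimal potential exists, because double transforms share the
modulus of continuity of the cost (\<open>optimal_potential_exists\<close>). The minimiser of \<open>c x y - \<psi> y\<close> is unique
for almost every \<open>x\<close> (\<open>AE_minimizer_unique\<close>): at a point with two minimisers the transform is the minimum of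
two functions with different slopes, and the points where such functions coincide form a set that
a line in a suitable direction meets at most once. Finally, the first variation of the dual functional at an optimal
potential in direction \<open>\<eta>\<close> is \<open>\<integral>\<eta> d\<nu> - \<integral>\<eta>(T x) d\<mu>\<close>, with \<open>T x\<close> the unique minimiser; it vanishes, so \<open>T\<close>
pushes \<open>\<mu>\<close> to \<open>\<nu>\<close> (\<open>minimizing_map_pushforward\<close>). Then \<open>\<psi>\<close> and \<open>T\<close> form a saddle pair, because the
potential drops out of \<open>F\<close> for transport maps.

Conversely, the map of any saddle pair is a transport map with almost all values minimisers, and the same
holds for every optimal map and every minimiser of \<open>F \<psi>\<close>, so they all coincide almost everywhere.
At a point with a unique minimiser \<open>y\<close> the transform has derivative \<open>G (x - y)\<close>
(\<open>ctr_has_derivative\<close>), almost everywhere it has no other one within \<open>X\<close> (\<open>AE_derivative_within_unique\<close>, again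
by sets that lines meet at most once), and inverting \<open>G\<close> gives the formula for \<open>T\<close>.
\<close>

section \<open>Lower semicontinuous functions on compact sets\<close>

lemma lsc_on_closed_sublevel:
  fixes f :: "'a::metric_space \<Rightarrow> real"
  assumes "closed S" "lsc_on S f"
  shows "closed {z\<in>S. f z \<le> a}"
  unfolding closed_sequential_limits
proof (intro allI impI, elim conjE)
  fix u z assume u: "\<forall>n. u n \<in> {z\<in>S. f z \<le> a}" and lim: "u \<longlonglongrightarrow> z"
  have zS: "z \<in> S"
    using u lim \<open>closed S\<close> unfolding closed_sequential_limits by blast
  have "f z \<le> a"
  proof (rule ccontr)
    assume *: "\<not> f z \<le> a"
    then have "eventually (\<lambda>w. a < f w) (at z within S)"
      using assms(2) zS by (auto simp: lsc_on_def)
    then obtain d where d: "d > 0" "\<And>w. w \<in> S \<Longrightarrow> w \<noteq> z \<Longrightarrow> dist w z < d \<Longrightarrow> a < f w"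
      by (auto simp: eventually_at)
    have "eventually (\<lambda>n. dist (u n) z < d) sequentially"
      using lim d(1) by (rule tendstoD)
    then obtain n where "dist (u n) z < d"
      by (auto simp: eventually_sequentially)
    then show False using d(2)[of "u n"] u * by (cases "u n = z") (auto simp: not_le dest!: spec[of _ n])
  qed
  with zS show "z \<in> {z\<in>S. f z \<le> a}" by simp
qed

lemma lsc_on_compact_sublevel:
  fixes f :: "'a::metric_space \<Rightarrow> real"
  assumes "compact S" "lsc_on S f"
  shows "compact {z\<in>S. f z \<le> a}"
proof -
  have "{z\<in>S. f z \<le> a} = S \<inter> {z\<in>S. f z \<le> a}" by auto
  then show ?thesis
    using assms lsc_on_closed_sublevel[of S f a] compact_imp_closed compact_Int_closed by metis
qed

lemma lsc_onI_sublevel: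
  fixes f :: "'a::metric_space \<Rightarrow> real"
  assumes "\<And>a. closed {z\<in>S. f z \<le> a}"
  shows "lsc_on S f"
  unfolding lsc_on_def
proof (intro ballI allI impI)
  fix z a assume "z \<in> S" "a < f z"
  then have "z \<in> - {z\<in>S. f z \<le> a}" "open (- {z\<in>S. f z \<le> a})"
    using assms by auto
  then have "eventually (\<lambda>w. w \<in> - {z\<in>S. f z \<le> a}) (at z within S)"
    by (rule topological_tendstoD[OF tendsto_ident_at, rotated])
  moreover have "eventually (\<lambda>w. w \<in> S) (at z within S)"
    by (simp add: eventually_at_filter)
  ultimately show "eventually (\<lambda>w. a < f w) (at z within S)"
    by eventually_elim auto
qed

text \<open>The sublevel sets through points of the domain form a family of compact sets directed by
  inclusion, so they have a common point; such a point is a minimiser.\<close>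

lemma attains_min_of_compact_sublevels:
  fixes f :: "'a::t2_space \<Rightarrow> real"
  assumes "S \<noteq> {}" "\<And>a. compact {z\<in>S. f z \<le> a}"
  obtains z where "z \<in> S" "\<And>w. w \<in> S \<Longrightarrow> f z \<le> f w"
proof -
  obtain s where s: "s \<in> S" using assms(1) by blast
  have "{z\<in>S. f z \<le> f s} \<inter> (\<Inter>w\<in>S. {z\<in>S. f z \<le> f w}) \<noteq> {}"
  proof (rule compact_imp_fip_image)
    fix I assume I: "finite I" "I \<subseteq> S"
    obtain m where m: "m \<in> insert s I" "\<And>w. w \<in> insert s I \<Longrightarrow> f m \<le> f w"
      using ex_is_arg_min_if_finite[of "insert s I" f] I by (auto simp: is_arg_min_linorder)
    have "m \<in> S" using m(1) I s by auto
    then have "m \<in> {z\<in>S. f z \<le> f s} \<inter> (\<Inter>w\<in>I. {z\<in>S. f z \<le> f w})"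
      using m(2) by auto
    then show "{z\<in>S. f z \<le> f s} \<inter> (\<Inter>w\<in>I. {z\<in>S. f z \<le> f w}) \<noteq> {}" by blast
  qed (use assms in \<open>auto intro: compact_imp_closed\<close>)
  then show ?thesis using that by blast
qed

lemma lsc_on_diff_continuous:
  fixes f g :: "'a::metric_space \<Rightarrow> real"
  assumes "lsc_on S f" "continuous_on S g"
  shows "lsc_on S (\<lambda>z. f z - g z)"
  unfolding lsc_on_def
proof (intro ballI allI impI)
  fix z a assume z: "z \<in> S" and a: "a < f z - g z"
  define e where "e = (f z - g z - a) / 2"
  have e: "e > 0" using a by (simp add: e_def)
  have 1: "eventually (\<lambda>w. f z - e < f w) (at z within S)"
    using assms(1) z e by (simp add: lsc_on_def)
  have "eventually (\<lambda>w. dist (g w) (g z) < e) (at z within S)"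
    using assms(2) z e by (auto simp: continuous_on intro: tendstoD)
  with 1 show "eventually (\<lambda>w. a < f w - g w) (at z within S)"
  proof eventually_elim
    case (elim w)
    then show ?case unfolding dist_real_def e_def by argo
  qed
qed

lemma continuous_on_imp_lsc_on: "continuous_on S f \<Longrightarrow> lsc_on S f" for f :: "'a::topological_space \<Rightarrow> real"
  by (auto simp: lsc_on_def continuous_on intro: order_tendstoD)

section \<open>Measurable selection\<close>

text \<open>The classical notion of a measurable correspondence: compact nonempty values that hit closed
  sets measurably. For singletons this is measurability of the function itself.\<close>

definition hit_measurable :: "'a measure \<Rightarrow> ('a \<Rightarrow> 'b::topological_space set) \<Rightarrow> bool" where
  "hit_measurable M A \<longleftrightarrow> (\<forall>x\<in>space M. compact (A x) \<and> A x \<noteq> {})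
     \<and> (\<forall>C. closed C \<longrightarrow> {x\<in>space M. A x \<inter> C \<noteq> {}} \<in> sets M)"

lemma hit_measurable_argmin:
  fixes g :: "'a \<Rightarrow> 'b::t2_space \<Rightarrow> real"
  assumes ne: "\<And>x. x \<in> space M \<Longrightarrow> A x \<noteq> {}"
    and cpt: "\<And>x a. x \<in> space M \<Longrightarrow> compact {y\<in>A x. g x y \<le> a}"
    and hit: "\<And>C a. closed C \<Longrightarrow> {x\<in>space M. \<exists>y\<in>A x \<inter> C. g x y \<le> a} \<in> sets M"
  shows "hit_measurable M (\<lambda>x. {y\<in>A x. \<forall>z\<in>A x. g x y \<le> g x z})"
  unfolding hit_measurable_def
proof (intro conjI ballI allI impI)
  fix x assume x: "x \<in> space M"
  obtain y where y: "y \<in> A x" "\<And>w. w \<in> A x \<Longrightarrow> g x y \<le> g x w"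
    using attains_min_of_compact_sublevels[OF ne[OF x] cpt[OF x]] by blast
  then have "{y\<in>A x. \<forall>z\<in>A x. g x y \<le> g x z} = {z\<in>A x. g x z \<le> g x y}"
    by (auto intro: order_trans)
  then show "compact {y\<in>A x. \<forall>z\<in>A x. g x y \<le> g x z}" using cpt[OF x] by simp
  show "{y\<in>A x. \<forall>z\<in>A x. g x y \<le> g x z} \<noteq> {}" using y by blast
next
  fix C :: "'b set" assume C: "closed C"
  \<comment> \<open>The minimum over the whole value is attained on \<open>C\<close> if and only if no rational level is
    reached on the value without being reached on \<open>C\<close>.\<close>
  have "{x\<in>space M. {y\<in>A x. \<forall>z\<in>A x. g x y \<le> g x z} \<inter> C \<noteq> {}}
      = (\<Inter>r\<in>\<rat>. (space M - {x\<in>space M. \<exists>y\<in>A x \<inter> UNIV. g x y \<le> r})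
           \<union> {x\<in>space M. \<exists>y\<in>A x \<inter> C. g x y \<le> r})" (is "?L = ?R")
  proof (intro equalityI subsetI)
    fix x assume "x \<in> ?L"
    then obtain y where y: "x \<in> space M" "y \<in> A x" "y \<in> C" "\<And>z. z \<in> A x \<Longrightarrow> g x y \<le> g x z"
      by blast
    have "\<exists>y\<in>A x \<inter> C. g x y \<le> r" if "z \<in> A x" "g x z \<le> r" for z r
      using y(2,3) order_trans[OF y(4)[OF that(1)] that(2)] by blast
    then show "x \<in> ?R" using y(1) by blast
  next
    fix x assume R: "x \<in> ?R"
    then have x: "x \<in> space M" using Rats_0 by blast
    obtain y where y: "y \<in> A x" "\<And>w. w \<in> A x \<Longrightarrow> g x y \<le> g x w"
      using attains_min_of_compact_sublevels[OF ne[OF x] cpt[OF x]] by blast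
    have hits: "\<exists>z\<in>A x \<inter> C. g x z \<le> r" if "r \<in> \<rat>" "g x y \<le> r" for r
      using R that y(1) by blast
    obtain r where r: "r \<in> \<rat>" "g x y \<le> r"
      using Rats_dense_in_real[of "g x y" "g x y + 1"] by (meson less_add_one less_imp_le)
    have "compact {z\<in>A x \<inter> C. g x z \<le> a}" for a
    proof -
      have "{z\<in>A x \<inter> C. g x z \<le> a} = {z\<in>A x. g x z \<le> a} \<inter> C" by auto
      then show ?thesis using cpt[OF x] C by (simp add: compact_Int_closed)
    qed
    moreover have "A x \<inter> C \<noteq> {}" using hits[OF r] by blast
    ultimately obtain v where v: "v \<in> A x \<inter> C" "\<And>w. w \<in> A x \<inter> C \<Longrightarrow> g x v \<le> g x w"
      using attains_min_of_compact_sublevels[of "A x \<inter> C" "g x"] by blast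
    have "g x v \<le> g x y"
    proof (rule ccontr)
      assume "\<not> ?thesis"
      then obtain r where "r \<in> \<rat>" "g x y < r" "r < g x v"
        using Rats_dense_in_real by (meson not_le)
      then show False using hits[of r] v(2) by (meson less_imp_le not_le order_trans)
    qed
    then have "v \<in> {y\<in>A x. \<forall>z\<in>A x. g x y \<le> g x z} \<inter> C"
      using v(1) order_trans[OF _ y(2)] by auto
    then show "x \<in> ?L" using x by blast
  qed
  also have "\<dots> \<in> sets M"
    using hit[OF closed_UNIV] hit[OF C] Rats_0
    by (intro sets.countable_INT' sets.Un sets.Diff sets.top countable_rat) blast+
  finally show "{x\<in>space M. {y\<in>A x. \<forall>z\<in>A x. g x y \<le> g x z} \<inter> C \<noteq> {}} \<in> sets M" .
qed

text \<open>Minimising one coordinate after the other keeps a correspondence measurable and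
  leaves a single point in each value, which is the selected one.\<close>

lemma hit_measurable_selection:
  fixes A :: "'a \<Rightarrow> 'b::euclidean_space set"
  assumes "hit_measurable M A"
  obtains t where "t \<in> borel_measurable M" "\<And>x. x \<in> space M \<Longrightarrow> t x \<in> A x"
proof -
  have "\<exists>A'. hit_measurable M A' \<and> (\<forall>x\<in>space M. A' x \<subseteq> A x
          \<and> (\<forall>y\<in>A' x. \<forall>z\<in>A' x. \<forall>b\<in>B. y \<bullet> b = z \<bullet> b))" if "finite B" for B :: "'b set"
    using that
  proof (induction B rule: finite_induct)
    case empty
    then show ?case using assms by (intro exI[of _ A]) auto
  next
    case (insert b B)
    then obtain A' where A': "hit_measurable M A'" "\<And>x. x \<in> space M \<Longrightarrow> A' x \<subseteq> A x"
      and B: "\<And>x y z b. \<lbrakk>x \<in> space M; y \<in> A' x; z \<in> A' x; b \<in> B\<rbrakk> \<Longrightarrow> y \<bullet> b = z \<bullet> b" by metis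
    define A'' where "A'' = (\<lambda>x. {y\<in>A' x. \<forall>z\<in>A' x. y \<bullet> b \<le> z \<bullet> b})"
    have half: "closed {y. y \<bullet> b \<le> a}" for a
      using closed_halfspace_le[of b a] by (simp add: inner_commute)
    have "hit_measurable M A''"
      unfolding A''_def
    proof (rule hit_measurable_argmin)
      fix x assume "x \<in> space M"
      then show "A' x \<noteq> {}" using A'(1) by (simp add: hit_measurable_def)
      fix a
      have "{y\<in>A' x. y \<bullet> b \<le> a} = A' x \<inter> {y. y \<bullet> b \<le> a}" by auto
      then show "compact {y\<in>A' x. y \<bullet> b \<le> a}"
        using A'(1) \<open>x \<in> space M\<close> half by (simp add: hit_measurable_def compact_Int_closed)
    next
      fix C :: "'b set" and a assume "closed C"
      have "{x\<in>space M. \<exists>y\<in>A' x \<inter> C. y \<bullet> b \<le> a}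
          = {x\<in>space M. A' x \<inter> (C \<inter> {y. y \<bullet> b \<le> a}) \<noteq> {}}" by auto
      also have "\<dots> \<in> sets M"
        using A'(1) closed_Int[OF \<open>closed C\<close> half] unfolding hit_measurable_def by blast
      finally show "{x\<in>space M. \<exists>y\<in>A' x \<inter> C. y \<bullet> b \<le> a} \<in> sets M" .
    qed
    moreover have "A'' x \<subseteq> A x" if "x \<in> space M" for x
      using A'(2)[OF that] by (auto simp: A''_def)
    moreover have "y \<bullet> b' = z \<bullet> b'"
      if "x \<in> space M" "y \<in> A'' x" "z \<in> A'' x" "b' \<in> insert b B" for x y z b'
      using that B[of x y z b'] by (auto simp: A''_def intro: antisym)
    ultimately show ?case by (intro exI[of _ A'']) blast
  qed
  from this[OF finite_Basis] obtain A' where A': "hit_measurable M A'"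
    and A'_spec: "\<forall>x\<in>space M. A' x \<subseteq> A x
          \<and> (\<forall>y\<in>A' x. \<forall>z\<in>A' x. \<forall>b\<in>Basis. y \<bullet> b = z \<bullet> b)" by (elim exE conjE)
  have sub: "A' x \<subseteq> A x" if "x \<in> space M" for x
    using A'_spec that by blast
  have eq: "y = z" if "x \<in> space M" "y \<in> A' x" "z \<in> A' x" for x y z
    by (rule euclidean_eqI) (use A'_spec that in blast)
  define t where "t = (\<lambda>x. SOME y. y \<in> A' x)"
  have t: "t x \<in> A' x" if "x \<in> space M" for x
    unfolding t_def using A' that by (auto simp: hit_measurable_def some_in_eq)
  have "t \<in> borel_measurable M"
    unfolding borel_eq_closed
  proof (rule measurable_measure_of)
    fix C :: "'b set" assume "C \<in> Collect closed"
    have "t -` C \<inter> space M = {x\<in>space M. A' x \<inter> C \<noteq> {}}"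
      using t eq by blast
    then show "t -` C \<inter> space M \<in> sets M"
      using A' \<open>C \<in> Collect closed\<close> by (simp add: hit_measurable_def)
  qed auto
  then show ?thesis using that t sub by blast
qed

section \<open>A criterion for negligible sets\<close>

text \<open>The translates of \<open>S\<close> by the multiples \<open>e / (n + 1)\<close> are pairwise disjoint and have equal
  measure, but they all lie in one bounded set.\<close>

lemma null_set_if_directionally_thin:
  fixes S :: "'a::euclidean_space set"
  assumes S: "compact S" and thin: "\<And>x s. x \<in> S \<Longrightarrow> s > 0 \<Longrightarrow> x + s *\<^sub>R e \<notin> S"
  shows "S \<in> null_sets lborel"
proof -
  define T where "T = (\<lambda>n::nat. (\<lambda>x. x + (1 / real (Suc n)) *\<^sub>R e) ` S)"
  have compT: "compact (T n)" for n
    unfolding T_def by (intro compact_continuous_image S continuous_intros)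
  have emT: "emeasure lborel (T n) = emeasure lborel S" for n
  proof -
    define v where "v = (1 / real (Suc n)) *\<^sub>R e"
    have "T n = (\<lambda>x. - v + x) -` S"
    proof (intro equalityI subsetI)
      fix z assume "z \<in> (\<lambda>x. - v + x) -` S"
      then have "- v + z \<in> S" "z = (- v + z) + v" by simp_all
      then show "z \<in> T n" unfolding T_def v_def by blast
    qed (auto simp: T_def v_def)
    moreover have "emeasure (distr lborel borel (\<lambda>x. - v + x)) S = emeasure lborel ((\<lambda>x. - v + x) -` S)"
      using S by (subst emeasure_distr) (simp_all add: borel_compact)
    ultimately show ?thesis by (simp only: lborel_distr_plus)
  qed
  have "disjoint_family T"
    unfolding disjoint_family_on_def
  proof (intro ballI impI, rule ccontr)
    have aux: False if "x \<in> S" "y \<in> S" "a < b" "x + a *\<^sub>R e = y + b *\<^sub>R e" for x y a b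
    proof -
      have "x = y + (b - a) *\<^sub>R e" using that(4) by (simp add: algebra_simps)
      then show False using thin[of y "b - a"] that by auto
    qed
    fix m n :: nat assume "m \<noteq> n" "T m \<inter> T n \<noteq> {}"
    then obtain x y where "x \<in> S" "y \<in> S"
      "x + (1 / real (Suc m)) *\<^sub>R e = y + (1 / real (Suc n)) *\<^sub>R e"
      unfolding T_def by blast
    moreover have "1 / real (Suc m) \<noteq> 1 / real (Suc n)" using \<open>m \<noteq> n\<close> by simp
    ultimately show False using aux by (metis linorder_less_linear)
  qed
  moreover have "range T \<subseteq> sets lborel"
    using compT by (auto intro: borel_compact)
  ultimately have "(\<Sum>n. emeasure lborel (T n)) = emeasure lborel (\<Union>n. T n)"
    by (intro suminf_emeasure)
  also have "\<dots> < \<infinity>"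
  proof (rule emeasure_bounded_finite)
    obtain b where b: "\<And>x. x \<in> S \<Longrightarrow> norm x \<le> b"
      using compact_imp_bounded[OF S] by (auto simp: bounded_iff)
    have "norm z \<le> b + norm e" if z: "z \<in> T n" for z n
    proof -
      obtain x where x: "x \<in> S" "z = x + (1 / real (Suc n)) *\<^sub>R e"
        using z unfolding T_def by blast
      have "norm z \<le> norm x + (1 / real (Suc n)) * norm e"
        unfolding x(2) by (rule order_trans[OF norm_triangle_ineq]) simp
      also have "\<dots> \<le> b + 1 * norm e" by (intro add_mono b x mult_right_mono) auto
      finally show ?thesis by simp
    qed
    then show "bounded (\<Union>n. T n)" unfolding bounded_iff by blast
  qed
  finally have "(\<Sum>n::nat. emeasure lborel S) < \<infinity>" by (simp add: emT)
  moreover have "(\<Sum>n::nat. emeasure lborel S) = emeasure lborel S * top"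
    by (simp flip: nn_integral_count_space_nat)
  ultimately have "emeasure lborel S = 0"
    by (auto simp: ennreal_mult_top split: if_splits)
  then show ?thesis using S by (auto simp: null_sets_def intro: borel_compact)
qed

section \<open>Integrals of functions that are bounded below\<close>

lemma ext_integral_mono:
  assumes "\<And>x. x \<in> space M \<Longrightarrow> f x \<le> g x"
  shows "ext_integral M f \<le> ext_integral M g"
  unfolding ext_integral_def
  by (intro ereal_minus_mono)
    (use assms in \<open>auto simp: less_eq_ennreal.rep_eq[symmetric] intro!: nn_integral_mono e2ennreal_mono\<close>)

lemma ext_integral_cong:
  assumes "\<And>x. x \<in> space M \<Longrightarrow> f x = g x"
  shows "ext_integral M f = ext_integral M g"
  by (intro antisym ext_integral_mono) (simp_all add: assms)

text \<open>A function bounded below has finite negative part on a finite measure space, so its integral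
  is the usual one or infinite.\<close>

lemma ext_integral_ereal:
  assumes "finite_measure M" "f \<in> borel_measurable M" "\<And>x. x \<in> space M \<Longrightarrow> K \<le> f x"
  shows "ext_integral M (\<lambda>x. ereal (f x)) = (if integrable M f then ereal (\<integral>x. f x \<partial>M) else \<infinity>)"
proof -
  interpret finite_measure M by fact
  have pos: "(\<integral>\<^sup>+ x. e2ennreal (ereal (f x)) \<partial>M) = (\<integral>\<^sup>+ x. ennreal (f x) \<partial>M)"
    by simp
  have neg: "(\<integral>\<^sup>+ x. e2ennreal (- ereal (f x)) \<partial>M) = (\<integral>\<^sup>+ x. ennreal (- f x) \<partial>M)"
    by simp
  have "(\<integral>\<^sup>+ x. ennreal (- f x) \<partial>M) \<le> (\<integral>\<^sup>+ x. ennreal (- K) \<partial>M)"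
    by (intro nn_integral_mono ennreal_leI) (use assms(3) in auto)
  also have "\<dots> < \<infinity>"
    using emeasure_finite[of "space M"] by (simp add: emeasure_eq_measure flip: ennreal_mult'')
  finally have negfin: "(\<integral>\<^sup>+ x. ennreal (- f x) \<partial>M) < \<infinity>" .
  show ?thesis
  proof (cases "integrable M f")
    case True
    then have "(\<integral>\<^sup>+ x. ennreal (f x) \<partial>M) < \<infinity>"
      by (auto simp: real_integrable_def less_top)
    with negfin show ?thesis
      unfolding ext_integral_def pos neg real_lebesgue_integral_def[OF True] using True
      by (cases "\<integral>\<^sup>+ x. ennreal (f x) \<partial>M"; cases "\<integral>\<^sup>+ x. ennreal (- f x) \<partial>M") auto
  next
    case False
    then have "(\<integral>\<^sup>+ x. ennreal (f x) \<partial>M) = \<infinity>"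
      using assms(2) negfin by (auto simp: real_integrable_def)
    with negfin False show ?thesis
      unfolding ext_integral_def pos neg by auto
  qed
qed

lemma ext_integral_diff:
  assumes M: "finite_measure M" and f: "f \<in> borel_measurable M" "\<And>x. x \<in> space M \<Longrightarrow> K \<le> f x"
    and g: "g \<in> borel_measurable M" "\<And>x. x \<in> space M \<Longrightarrow> \<bar>g x\<bar> \<le> L"
  shows "ext_integral M (\<lambda>x. ereal (f x - g x)) = ext_integral M (\<lambda>x. ereal (f x)) - ereal (\<integral>x. g x \<partial>M)"
proof -
  interpret finite_measure M by fact
  have intg: "integrable M g"
    by (rule integrable_const_bound[of _ L]) (use g in auto)
  have eq: "integrable M (\<lambda>x. f x - g x) \<longleftrightarrow> integrable M f"
  proof
    assume "integrable M (\<lambda>x. f x - g x)"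
    from Bochner_Integration.integrable_add[OF this intg] show "integrable M f" by simp
  next
    assume "integrable M f"
    then show "integrable M (\<lambda>x. f x - g x)" using intg by (rule Bochner_Integration.integrable_diff)
  qed
  have "K - L \<le> f x - g x" if "x \<in> space M" for x
    using f(2)[OF that] g(2)[OF that] by linarith
  then show ?thesis
    using f g ext_integral_ereal[OF M, of f K] ext_integral_ereal[OF M, of "\<lambda>x. f x - g x" "K - L"]
    by (simp add: eq intg)
qed

lemma AE_eq_if_ext_integral_eq:
  assumes M: "finite_measure M" and f: "f \<in> borel_measurable M" and g: "g \<in> borel_measurable M"
    and le: "\<And>x. x \<in> space M \<Longrightarrow> f x \<le> g x" and lb: "\<And>x. x \<in> space M \<Longrightarrow> K \<le> f x"
    and eq: "ext_integral M (\<lambda>x. ereal (f x)) = ext_integral M (\<lambda>x. ereal (g x))"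
    and fin: "ext_integral M (\<lambda>x. ereal (f x)) < \<infinity>"
  shows "AE x in M. f x = g x"
proof -
  have K: "K \<le> g x" if "x \<in> space M" for x using le[OF that] lb[OF that] by simp
  have int: "integrable M f" "integrable M g" "(\<integral>x. f x \<partial>M) = (\<integral>x. g x \<partial>M)"
    using eq fin ext_integral_ereal[OF M f lb] ext_integral_ereal[OF M g K] by (auto split: if_splits)
  then have "AE x in M. g x - f x = 0"
    by (subst integral_nonneg_eq_0_iff_AE[symmetric]) (use le in auto)
  then show ?thesis by eventually_elim simp
qed

section \<open>Semicontinuous functions as suprema of continuous ones\<close>

text \<open>The Lipschitz regularisations \<open>x \<mapsto> inf z. f z + n * dist x z\<close> increase to \<open>f\<close>. Hence a
  bound for the integrals of all continuous functions below \<open>f\<close> is a bound for the integral of \<open>f\<close>.\<close>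

lemma ext_integral_le_if_continuous_below:
  fixes f :: "'a::metric_space \<Rightarrow> real"
  assumes M: "finite_measure M" and sp: "space M = S" and sets: "sets M = sets (restrict_space borel S)"
    and S: "compact S" "S \<noteq> {}" and lsc: "lsc_on S f" and meas: "f \<in> borel_measurable M"
    and bound: "\<And>g. continuous_on S g \<Longrightarrow> (\<And>x. x \<in> S \<Longrightarrow> g x \<le> f x) \<Longrightarrow> ereal (\<integral>x. g x \<partial>M) \<le> B"
  shows "ext_integral M (\<lambda>x. ereal (f x)) \<le> B"
proof -
  interpret finite_measure M by fact
  obtain w where w: "w \<in> S" "\<And>x. x \<in> S \<Longrightarrow> f w \<le> f x"
    using attains_min_of_compact_sublevels[OF S(2) lsc_on_compact_sublevel[OF S(1) lsc]] by blast
  define K where "K = f w"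
  define g where "g = (\<lambda>n::nat. \<lambda>x. INF z\<in>S. f z + real n * dist x z)"
  have bdd: "bdd_below ((\<lambda>z. f z + real n * dist x z) ` S)" for n x
    by (rule bdd_belowI2[of _ K]) (use w in \<open>auto simp: K_def intro: add_increasing2\<close>)
  have gK: "K \<le> g n x" for n x
    unfolding g_def by (rule cINF_greatest[OF S(2)]) (use w in \<open>auto simp: K_def intro: add_increasing2\<close>)
  have g_le: "g n x \<le> f z + real n * dist x z" if "z \<in> S" for n x z
    unfolding g_def by (rule cINF_lower[OF bdd that])
  have gf: "g n x \<le> f x" if "x \<in> S" for n x
    using g_le[OF that, of n x] by simp
  have lip: "g n x \<le> g n y + real n * dist x y" for n x y
  proof -
    have "g n x - real n * dist x y \<le> g n y"
      unfolding g_def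
    proof (rule cINF_greatest[OF S(2)])
      fix z assume "z \<in> S"
      have "g n x \<le> f z + real n * dist x z" by (rule g_le[OF \<open>z \<in> S\<close>])
      also have "\<dots> \<le> f z + real n * (dist x y + dist y z)"
        by (intro add_left_mono mult_left_mono dist_triangle) auto
      finally show "(INF z\<in>S. f z + real n * dist x z) - real n * dist x y \<le> f z + real n * dist y z"
        by (simp add: algebra_simps g_def)
    qed
    then show ?thesis by simp
  qed
  have cont: "continuous_on S (g n)" for n
  proof -
    have "n-lipschitz_on S (g n)"
    proof (rule lipschitz_onI)
      fix x y
      show "dist (g n x) (g n y) \<le> real n * dist x y"
        using lip[of n x y] lip[of n y x] by (simp add: dist_real_def abs_le_iff dist_commute[of y x])
    qed simp
    then show ?thesis by (rule lipschitz_on_continuous_on)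
  qed
  have gm: "g n \<in> borel_measurable M" for n
    using borel_measurable_continuous_on_restrict[OF cont] sets by (simp cong: measurable_cong_sets)
  have mono: "g m x \<le> g n x" if "m \<le> n" for m n x
    unfolding g_def by (rule cINF_mono[OF S(2) bdd]) (use that in \<open>auto intro!: bexI mult_right_mono\<close>)
  have conv: "\<exists>n. a < g n x" if xS: "x \<in> S" and ax: "a < f x" for x a
  proof -
    obtain b where b: "a < b" "b < f x" using dense[OF ax] by blast
    then have "eventually (\<lambda>w. b < f w) (at x within S)"
      using lsc xS by (simp add: lsc_on_def)
    then obtain d where d: "d > 0" "\<And>w. w \<in> S \<Longrightarrow> w \<noteq> x \<Longrightarrow> dist w x < d \<Longrightarrow> b < f w"
      by (auto simp: eventually_at)
    obtain n :: nat where n: "(b - K) / d < n" using reals_Archimedean2 by blast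
    have "b \<le> g n x"
      unfolding g_def
    proof (rule cINF_greatest[OF S(2)])
      fix z assume z: "z \<in> S"
      show "b \<le> f z + real n * dist x z"
      proof (cases "dist z x < d")
        case True
        then have "b \<le> f z" using d(2)[OF z] b(2) by (cases "z = x") auto
        then show ?thesis by (simp add: add_increasing2)
      next
        case False
        then have "b - K \<le> real n * d" using n d(1) by (simp add: pos_divide_less_eq less_imp_le)
        also have "\<dots> \<le> real n * dist x z" using False by (intro mult_left_mono) (auto simp: dist_commute)
        finally show ?thesis using w(2)[OF z] by (simp add: K_def)
      qed
    qed
    then show ?thesis using b(1) by (intro exI[of _ n]) simp
  qed
  have sup: "(SUP n. ennreal (g n x - K)) = ennreal (f x - K)" if xS: "x \<in> S" for x
  proof (rule antisym)
    show "(SUP n. ennreal (g n x - K)) \<le> ennreal (f x - K)"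
      by (intro SUP_least ennreal_leI) (use gf[OF xS] in auto)
    show "ennreal (f x - K) \<le> (SUP n. ennreal (g n x - K))"
    proof (rule dense_le)
      fix a assume a: "a < ennreal (f x - K)"
      then obtain r where r: "a = ennreal r" "r \<ge> 0" by (cases a) auto
      then have "r + K < f x" using a by (simp add: ennreal_less_iff)
      then obtain n where "r + K < g n x" using conv[OF xS] by blast
      then have "a \<le> ennreal (g n x - K)" using r by (simp add: ennreal_leI)
      then show "a \<le> (SUP n. ennreal (g n x - K))" by (rule SUP_upper2[OF UNIV_I])
    qed
  qed
  have int: "integrable M (g n)" for n
  proof -
    obtain b where "\<And>x. x \<in> S \<Longrightarrow> norm (g n x) \<le> b"
      using compact_imp_bounded[OF compact_continuous_image[OF cont[of n] S(1)]] by (auto simp: bounded_iff)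
    then show ?thesis by (intro integrable_const_bound[of _ b] gm) (auto simp: sp)
  qed
  define V where "V = measure M S"
  have nn: "(\<integral>\<^sup>+ x. ennreal (f x - K) \<partial>M) = (SUP n. ennreal ((\<integral>x. g n x \<partial>M) - K * V))"
  proof -
    have "(\<integral>\<^sup>+ x. ennreal (f x - K) \<partial>M) = (\<integral>\<^sup>+ x. (SUP n. ennreal (g n x - K)) \<partial>M)"
      by (intro nn_integral_cong) (simp add: sup sp)
    also have "\<dots> = (SUP n. \<integral>\<^sup>+ x. ennreal (g n x - K) \<partial>M)"
      by (intro nn_integral_monotone_convergence_SUP)
        (use gm mono in \<open>auto simp: incseq_def le_fun_def intro!: ennreal_leI\<close>)
    also have "\<dots> = (SUP n. ennreal ((\<integral>x. g n x \<partial>M) - K * V))"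
      by (subst nn_integral_eq_integral)
        (use int gK in \<open>auto simp: V_def sp mult.commute\<close>)
    finally show ?thesis .
  qed
  have gB: "ereal (\<integral>x. g n x \<partial>M) \<le> B" for n
    by (rule bound[OF cont gf])
  show ?thesis
  proof (cases B)
    case (real b)
    have le: "(\<integral>\<^sup>+ x. ennreal (f x - K) \<partial>M) \<le> ennreal (b - K * V)"
      unfolding nn using gB real by (intro SUP_least ennreal_leI) auto
    have fK: "(\<lambda>x. f x - K) \<in> borel_measurable M" using meas by simp
    have nonneg: "AE x in M. 0 \<le> f x - K" using w(2) by (auto simp: K_def sp)
    have bK: "0 \<le> b - K * V"
    proof -
      have "K * V = (\<integral>x. K \<partial>M)" by (simp add: V_def sp)
      also have "\<dots> \<le> (\<integral>x. g 0 x \<partial>M)" by (intro integral_mono int gK) simp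
      finally show ?thesis using gB[of 0] real by simp
    qed
    have I: "integrable M (\<lambda>x. f x - K)"
      using le by (intro integrableI_nonneg fK nonneg) (auto intro: le_less_trans)
    have I_le: "(\<integral>x. f x - K \<partial>M) \<le> b - K * V"
      using le bK by (subst (asm) nn_integral_eq_integral[OF I nonneg]) simp
    have "integrable M f" using Bochner_Integration.integrable_add[OF I, of "\<lambda>_. K"] by simp
    moreover from this have "(\<integral>x. f x \<partial>M) \<le> b" using I_le by (simp add: V_def sp mult.commute)
    moreover have "ext_integral M (\<lambda>x. ereal (f x)) = (if integrable M f then ereal (\<integral>x. f x \<partial>M) else \<infinity>)"
      by (rule ext_integral_ereal[OF M meas, of K]) (use w(2) in \<open>simp add: K_def sp\<close>)
    ultimately show ?thesis by (simp add: real)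
  qed (use gB in auto)
qed

section \<open>Continuous functions separate finite measures\<close>

text \<open>The indicator of a closed set \<open>C\<close> is the pointwise limit of the continuous functions
  \<open>max 0 (1 - n * infdist x C)\<close>, and closed sets are an intersection-stable generator.\<close>

lemma continuous_integrals_determine_measure:
  fixes M N :: "'a::metric_space measure"
  assumes M: "finite_measure M" "finite_measure N"
    and sM: "sets M = sets (restrict_space borel S)" and sN: "sets N = sets (restrict_space borel S)"
    and S: "compact S"
    and eq: "\<And>g :: 'a \<Rightarrow> real. continuous_on S g \<Longrightarrow> (\<integral>x. g x \<partial>M) = (\<integral>x. g x \<partial>N)"
  shows "M = N"
proof -
  interpret M: finite_measure M by fact
  interpret N: finite_measure N by fact
  have sp: "space M = S" "space N = S"
    using sets_eq_imp_space_eq[OF sM] sets_eq_imp_space_eq[OF sN] by (simp_all add: space_restrict_space)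
  have lim: "(\<lambda>n. \<integral>x. max 0 (1 - real n * infdist x C) \<partial>K) \<longlonglongrightarrow> (\<integral>x. indicator (S \<inter> C) x \<partial>K)"
    if K: "finite_measure K" and sK: "sets K = sets (restrict_space borel S)" and C: "closed C" "C \<noteq> {}" for K C
  proof -
    interpret finite_measure K by fact
    have spK: "space K = S"
      using sets_eq_imp_space_eq[OF sK] by (simp add: space_restrict_space)
    show ?thesis
    proof (rule integral_dominated_convergence[where w = "\<lambda>_. 1"])
      show "AE x in K. (\<lambda>n. max 0 (1 - real n * infdist x C)) \<longlonglongrightarrow> indicator (S \<inter> C) x"
      proof (rule AE_I2)
        fix x assume x: "x \<in> space K"
        show "(\<lambda>n. max 0 (1 - real n * infdist x C)) \<longlonglongrightarrow> indicator (S \<inter> C) x"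
        proof (cases "x \<in> C")
          case True
          then have "infdist x C = 0" by simp
          then show ?thesis using True x by (simp add: spK)
        next
          case False
          then have pos: "infdist x C > 0"
            using C infdist_nonneg[of x C] in_closed_iff_infdist_zero[of C x] by simp
          obtain m :: nat where m: "1 / infdist x C < m" using reals_Archimedean2 by blast
          have "eventually (\<lambda>n. max 0 (1 - real n * infdist x C) = 0) sequentially"
          proof (rule eventually_sequentiallyI[of m])
            fix n assume "m \<le> n"
            then have "1 / infdist x C \<le> real n" using m by simp
            then show "max 0 (1 - real n * infdist x C) = 0"
              using pos by (simp add: pos_divide_le_eq)
          qed
          then show ?thesis using False by (simp add: tendsto_eventually)
        qed
      qed
      have "(\<lambda>x. max 0 (1 - real n * infdist x C)) \<in> borel_measurable (restrict_space borel S)" for n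
        by (intro borel_measurable_continuous_on_restrict continuous_intros)
      then show "(\<lambda>x. max 0 (1 - real n * infdist x C)) \<in> borel_measurable K" for n
        using sK by (simp cong: measurable_cong_sets)
      show "(indicator (S \<inter> C) :: 'a \<Rightarrow> real) \<in> borel_measurable K"
        using C(1) sK by (auto intro!: borel_measurable_indicator simp: sets_restrict_space)
      show "AE x in K. norm (max 0 (1 - real n * infdist x C)) \<le> 1" for n
        by (auto simp: infdist_nonneg)
    qed simp
  qed
  have closed_eq: "emeasure M (S \<inter> C) = emeasure N (S \<inter> C)" if C: "closed C" for C
  proof (cases "C = {}")
    case False
    have "(\<integral>x. max 0 (1 - real n * infdist x C) \<partial>M) = (\<integral>x. max 0 (1 - real n * infdist x C) \<partial>N)" for n
      by (intro eq continuous_intros)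
    then have "(\<integral>x. indicator (S \<inter> C) x \<partial>M) = (\<integral>x. indicator (S \<inter> C) x \<partial>N :: real)"
      using LIMSEQ_unique[OF lim[OF M(1) sM C False]] lim[OF M(2) sN C False] by simp
    then show ?thesis
      using sp by (simp add: M.emeasure_eq_measure N.emeasure_eq_measure Int_absorb1 Int_commute)
  qed simp
  let ?E = "(\<inter>) S ` Collect closed"
  have gen: "sets (restrict_space borel S) = sigma_sets S ?E"
    unfolding borel_eq_closed sets_restrict_space
    using S by (subst sigma_sets_Int[symmetric]) (auto simp: compact_imp_closed)
  show ?thesis
  proof (rule measure_eqI_generator_eq[of ?E S M N "\<lambda>_. S"])
    show "Int_stable ?E"
    proof (rule Int_stableI_image)
      fix C D :: "'a set" assume "C \<in> Collect closed" "D \<in> Collect closed"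
      then show "\<exists>k\<in>Collect closed. S \<inter> C \<inter> (S \<inter> D) = S \<inter> k"
        by (intro bexI[of _ "C \<inter> D"]) auto
    qed
    show "\<And>A. A \<in> ?E \<Longrightarrow> emeasure M A = emeasure N A" using closed_eq by auto
    show "sets M = sigma_sets S ?E" "sets N = sigma_sets S ?E" using sM sN gen by simp_all
    show "range (\<lambda>_::nat. S) \<subseteq> ?E" by (auto intro!: image_eqI[where x = UNIV])
    show "emeasure M S \<noteq> \<infinity>" by simp
  qed auto
qed

section \<open>The transport problem\<close>

locale transport =
  fixes X :: "'a::euclidean_space set" and Y :: "'b::euclidean_space set"
    and \<mu> :: "'a measure" and \<nu> :: "'b measure" and c :: "'a \<Rightarrow> 'b \<Rightarrow> real"
  assumes compact_X: "compact X" and compact_Y: "compact Y"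
    and \<mu>: "borel_prob_on X \<mu>" and \<nu>: "borel_prob_on Y \<nu>"
    and lsc_cost: "lsc_on (X \<times> Y) (\<lambda>(x, y). c x y)"

sublocale transport \<subseteq> \<mu>: prob_space \<mu> using \<mu> by (simp add: borel_prob_on_def)
sublocale transport \<subseteq> \<nu>: prob_space \<nu> using \<nu> by (simp add: borel_prob_on_def)

context transport
begin

lemma sets_\<mu>: "sets \<mu> = sets (restrict_space borel X)"
  and sets_\<nu>: "sets \<nu> = sets (restrict_space borel Y)"
  using \<mu> \<nu> by (simp_all add: borel_prob_on_def)

lemma space_\<mu>: "space \<mu> = X" and space_\<nu>: "space \<nu> = Y"
  using sets_eq_imp_space_eq[OF sets_\<mu>] sets_eq_imp_space_eq[OF sets_\<nu>]
  by (simp_all add: space_restrict_space)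

lemma X_nonempty: "X \<noteq> {}" and Y_nonempty: "Y \<noteq> {}"
  using \<mu>.not_empty \<nu>.not_empty by (simp_all add: space_\<mu> space_\<nu>)

lemma closed_sets_\<mu>: "closed S \<Longrightarrow> S \<subseteq> X \<Longrightarrow> S \<in> sets \<mu>"
  using sets_restrict_space_iff[of X borel S] compact_X
  by (simp add: sets_\<mu> compact_imp_closed)

lemma closed_sets_\<nu>: "closed S \<Longrightarrow> S \<subseteq> Y \<Longrightarrow> S \<in> sets \<nu>"
  using sets_restrict_space_iff[of Y borel S] compact_Y
  by (simp add: sets_\<nu> compact_imp_closed)

lemma measurable_\<mu>_\<nu>I:
  assumes "t \<in> borel_measurable \<mu>" "\<And>x. x \<in> X \<Longrightarrow> t x \<in> Y"
  shows "t \<in> measurable \<mu> \<nu>"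
proof -
  have "t \<in> measurable \<mu> (restrict_space borel Y)"
    using assms by (intro measurable_restrict_space2) (auto simp: space_\<mu>)
  then show ?thesis by (simp add: measurable_cong_sets[OF refl sets_\<nu>])
qed

lemma measurable_\<mu>_\<nu>D:
  assumes "t \<in> measurable \<mu> \<nu>"
  shows "t \<in> borel_measurable \<mu>" "\<And>x. x \<in> X \<Longrightarrow> t x \<in> Y"
proof -
  have "t \<in> measurable \<mu> (restrict_space borel Y)"
    using assms by (simp add: measurable_cong_sets[OF refl sets_\<nu>])
  then show "t \<in> borel_measurable \<mu>" by (simp add: measurable_restrict_space2_iff)
  show "\<And>x. x \<in> X \<Longrightarrow> t x \<in> Y"
    using measurable_space[OF assms] by (simp add: space_\<mu> space_\<nu>)
qed

lemma continuous_bounded_on_Y: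
  fixes \<psi> :: "'b \<Rightarrow> real"
  assumes "continuous_on Y \<psi>"
  obtains B where "\<And>y. y \<in> Y \<Longrightarrow> \<bar>\<psi> y\<bar> \<le> B"
  using compact_imp_bounded[OF compact_continuous_image[OF assms compact_Y]]
  by (auto simp: bounded_iff)

lemma continuous_measurable_\<nu>:
  fixes \<psi> :: "'b \<Rightarrow> real"
  shows "continuous_on Y \<psi> \<Longrightarrow> \<psi> \<in> borel_measurable \<nu>"
  using borel_measurable_continuous_on_restrict[of Y \<psi>] sets_\<nu>
  by (simp cong: measurable_cong_sets)

lemma integrable_\<nu>_continuous:
  fixes \<psi> :: "'b \<Rightarrow> real"
  assumes "continuous_on Y \<psi>"
  shows "integrable \<nu> \<psi>"
proof -
  obtain B where "\<And>y. y \<in> Y \<Longrightarrow> \<bar>\<psi> y\<bar> \<le> B" using continuous_bounded_on_Y[OF assms] by blast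
  then show ?thesis
    by (intro \<nu>.integrable_const_bound[of _ B] continuous_measurable_\<nu> assms) (auto simp: space_\<nu>)
qed

lemma integrable_\<mu>_continuous_comp:
  fixes \<psi> :: "'b \<Rightarrow> real"
  assumes "continuous_on Y \<psi>" "t \<in> measurable \<mu> \<nu>"
  shows "integrable \<mu> (\<lambda>x. \<psi> (t x))"
proof -
  obtain B where "\<And>y. y \<in> Y \<Longrightarrow> \<bar>\<psi> y\<bar> \<le> B" using continuous_bounded_on_Y[OF assms(1)] by blast
  then show ?thesis
    using measurable_compose[OF assms(2) continuous_measurable_\<nu>[OF assms(1)]] measurable_\<mu>_\<nu>D(2)[OF assms(2)]
    by (intro \<mu>.integrable_const_bound[of _ B]) (auto simp: space_\<mu>)
qed

lemma cost_lower_bound: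
  obtains K where "\<And>x y. x \<in> X \<Longrightarrow> y \<in> Y \<Longrightarrow> K \<le> c x y"
proof -
  obtain z where z: "z \<in> X \<times> Y" "\<And>w. w \<in> X \<times> Y \<Longrightarrow> (\<lambda>(x, y). c x y) z \<le> (\<lambda>(x, y). c x y) w"
    by (rule attains_min_of_compact_sublevels[OF _ lsc_on_compact_sublevel[OF compact_Times[OF compact_X compact_Y] lsc_cost]])
      (use X_nonempty Y_nonempty in auto)
  then show ?thesis using that[of "c (fst z) (snd z)"] by fastforce
qed

subsection \<open>The c-transform of a continuous function\<close>

lemma lsc_reduced_cost:
  assumes "continuous_on Y \<psi>"
  shows "lsc_on (X \<times> Y) (\<lambda>z. c (fst z) (snd z) - \<psi> (snd z))"
proof -
  have "continuous_on (X \<times> Y) (\<lambda>z. \<psi> (snd z))"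
    by (intro continuous_on_compose2[OF assms] continuous_intros) auto
  then show ?thesis
    using lsc_on_diff_continuous[OF lsc_cost] by (simp add: case_prod_unfold)
qed

text \<open>All sublevel sets that matter are compact because they are projections of compact ones.\<close>

lemma compact_reduced_sublevel:
  assumes "continuous_on Y \<psi>" "closed C"
  shows "compact {x\<in>X. \<exists>y\<in>Y \<inter> C. c x y - \<psi> y \<le> a}"
proof -
  have "compact ({z\<in>X \<times> Y. c (fst z) (snd z) - \<psi> (snd z) \<le> a} \<inter> UNIV \<times> C)"
    by (intro compact_Int_closed lsc_on_compact_sublevel compact_Times compact_X compact_Y
        lsc_reduced_cost assms closed_Times closed_UNIV)
  then have "compact (fst ` ({z\<in>X \<times> Y. c (fst z) (snd z) - \<psi> (snd z) \<le> a} \<inter> UNIV \<times> C))"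
    by (intro compact_continuous_image continuous_intros)
  moreover have "fst ` ({z\<in>X \<times> Y. c (fst z) (snd z) - \<psi> (snd z) \<le> a} \<inter> UNIV \<times> C)
      = {x\<in>X. \<exists>y\<in>Y \<inter> C. c x y - \<psi> y \<le> a}"
    by force
  ultimately show ?thesis by simp
qed

lemma compact_reduced_fibre:
  assumes "continuous_on Y \<psi>" "x \<in> X"
  shows "compact {y\<in>Y. c x y - \<psi> y \<le> a}"
proof -
  have "compact ({z\<in>X \<times> Y. c (fst z) (snd z) - \<psi> (snd z) \<le> a} \<inter> {x} \<times> UNIV)"
    by (intro compact_Int_closed lsc_on_compact_sublevel compact_Times compact_X compact_Y
        lsc_reduced_cost assms closed_Times closed_UNIV) simp
  then have "compact (snd ` ({z\<in>X \<times> Y. c (fst z) (snd z) - \<psi> (snd z) \<le> a} \<inter> {x} \<times> UNIV))"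
    by (intro compact_continuous_image continuous_intros)
  moreover have "snd ` ({z\<in>X \<times> Y. c (fst z) (snd z) - \<psi> (snd z) \<le> a} \<inter> {x} \<times> UNIV)
      = {y\<in>Y. c x y - \<psi> y \<le> a}"
    using assms(2) by force
  ultimately show ?thesis by simp
qed

text \<open>A lower semicontinuous function attains its minimum on the compact set \<open>Y\<close>, so the transform of a
  continuous function is real-valued on \<open>X\<close> and agrees there with this infimum of reals.\<close>

definition ctr :: "('b \<Rightarrow> real) \<Rightarrow> 'a \<Rightarrow> real" where
  "ctr \<psi> x = (INF y\<in>Y. c x y - \<psi> y)"

definition minimizers :: "('b \<Rightarrow> real) \<Rightarrow> 'a \<Rightarrow> 'b set" where
  "minimizers \<psi> x = {y\<in>Y. \<forall>z\<in>Y. c x y - \<psi> y \<le> c x z - \<psi> z}"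

lemma minimizers_nonempty:
  assumes "continuous_on Y \<psi>" "x \<in> X"
  shows "minimizers \<psi> x \<noteq> {}"
proof -
  obtain y where "y \<in> Y" "\<And>z. z \<in> Y \<Longrightarrow> c x y - \<psi> y \<le> c x z - \<psi> z"
    using attains_min_of_compact_sublevels[OF Y_nonempty compact_reduced_fibre[OF assms]] by blast
  then show ?thesis unfolding minimizers_def by blast
qed

lemma ctr_eq_minimizer: "y \<in> minimizers \<psi> x \<Longrightarrow> ctr \<psi> x = c x y - \<psi> y"
  unfolding ctr_def minimizers_def
  by (intro cInf_eq_minimum) (auto intro: imageI)

lemma minimizer_in_Y: "y \<in> minimizers \<psi> x \<Longrightarrow> y \<in> Y"
  by (simp add: minimizers_def)

lemma ctr_le:
  assumes "continuous_on Y \<psi>" "x \<in> X" "y \<in> Y"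
  shows "ctr \<psi> x \<le> c x y - \<psi> y"
proof -
  obtain z where "z \<in> minimizers \<psi> x" using minimizers_nonempty[OF assms(1,2)] by blast
  then show ?thesis using assms(3) by (simp add: ctr_eq_minimizer) (simp add: minimizers_def)
qed

lemma minimizer_iff_ctr:
  assumes "continuous_on Y \<psi>" "x \<in> X" "y \<in> Y"
  shows "y \<in> minimizers \<psi> x \<longleftrightarrow> c x y - \<psi> y = ctr \<psi> x"
  using ctr_le[OF assms(1,2)] assms(3) by (auto simp: ctr_eq_minimizer) (simp add: minimizers_def)

lemma ctr_greatest:
  assumes "\<And>y. y \<in> Y \<Longrightarrow> b \<le> c x y - \<psi> y"
  shows "b \<le> ctr \<psi> x"
  unfolding ctr_def by (rule cINF_greatest[OF Y_nonempty assms])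

lemma ctrans_Y_eq_ctr:
  assumes "continuous_on Y \<psi>" "x \<in> X"
  shows "ctrans_Y c Y (\<lambda>y. ereal (\<psi> y)) x = ereal (ctr \<psi> x)"
proof -
  obtain z where z: "z \<in> minimizers \<psi> x" using minimizers_nonempty[OF assms] by blast
  show ?thesis
    unfolding ctrans_Y_def
  proof (rule antisym)
    show "(INF y\<in>Y. ereal (c x y) - ereal (\<psi> y)) \<le> ereal (ctr \<psi> x)"
      using z by (intro INF_lower2[of z]) (simp_all add: ctr_eq_minimizer minimizer_in_Y)
    show "ereal (ctr \<psi> x) \<le> (INF y\<in>Y. ereal (c x y) - ereal (\<psi> y))"
      using ctr_le[OF assms] by (intro INF_greatest) simp
  qed
qed

lemma lsc_on_ctr:
  assumes "continuous_on Y \<psi>"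
  shows "lsc_on X (ctr \<psi>)"
proof (rule lsc_onI_sublevel)
  fix a
  have "{x\<in>X. ctr \<psi> x \<le> a} = {x\<in>X. \<exists>y\<in>Y \<inter> UNIV. c x y - \<psi> y \<le> a}"
  proof (intro equalityI subsetI)
    fix x assume "x \<in> {x\<in>X. ctr \<psi> x \<le> a}"
    then have x: "x \<in> X" "ctr \<psi> x \<le> a" by simp_all
    obtain y where "y \<in> minimizers \<psi> x" using minimizers_nonempty[OF assms x(1)] by blast
    then show "x \<in> {x\<in>X. \<exists>y\<in>Y \<inter> UNIV. c x y - \<psi> y \<le> a}"
      using x minimizer_in_Y by (auto simp: ctr_eq_minimizer)
  next
    fix x assume "x \<in> {x\<in>X. \<exists>y\<in>Y \<inter> UNIV. c x y - \<psi> y \<le> a}"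
    then obtain y where "x \<in> X" "y \<in> Y" "c x y - \<psi> y \<le> a" by blast
    then show "x \<in> {x\<in>X. ctr \<psi> x \<le> a}"
      using ctr_le[OF assms, of x y] by simp
  qed
  then show "closed {x\<in>X. ctr \<psi> x \<le> a}"
    using compact_imp_closed[OF compact_reduced_sublevel[OF assms closed_UNIV]] by simp
qed

lemma ctr_lower_bound:
  assumes "continuous_on Y \<psi>"
  obtains K where "\<And>x. x \<in> X \<Longrightarrow> K \<le> ctr \<psi> x"
proof -
  obtain B where B: "\<And>y. y \<in> Y \<Longrightarrow> \<bar>\<psi> y\<bar> \<le> B" using continuous_bounded_on_Y[OF assms] by blast
  obtain K where K: "\<And>x y. x \<in> X \<Longrightarrow> y \<in> Y \<Longrightarrow> K \<le> c x y" using cost_lower_bound by blast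
  have "K - B \<le> ctr \<psi> x" if "x \<in> X" for x
    by (rule ctr_greatest) (use K[OF that] B in \<open>force simp: abs_le_iff\<close>)
  then show ?thesis using that by blast
qed

lemma measurable_from_sublevels:
  fixes f :: "'a \<Rightarrow> real"
  assumes "\<And>a. closed {x\<in>X. f x \<le> a}"
  shows "f \<in> borel_measurable \<mu>"
  unfolding borel_measurable_iff_le space_\<mu> by (intro allI closed_sets_\<mu> assms) auto

lemma measurable_ctr: "continuous_on Y \<psi> \<Longrightarrow> ctr \<psi> \<in> borel_measurable \<mu>"
  by (intro measurable_from_sublevels lsc_on_closed_sublevel lsc_on_ctr compact_imp_closed compact_X)

lemma minimizing_map:
  assumes "continuous_on Y \<psi>"
  obtains t where "t \<in> measurable \<mu> \<nu>" "\<And>x. x \<in> X \<Longrightarrow> t x \<in> minimizers \<psi> x"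
proof -
  have "hit_measurable \<mu> (minimizers \<psi>)"
    unfolding minimizers_def
  proof (rule hit_measurable_argmin)
    show "{x\<in>space \<mu>. \<exists>y\<in>Y \<inter> C. c x y - \<psi> y \<le> a} \<in> sets \<mu>" if "closed C" for C a
      unfolding space_\<mu>
      by (intro closed_sets_\<mu> compact_imp_closed compact_reduced_sublevel assms that) auto
  qed (use Y_nonempty compact_reduced_fibre[OF assms] in \<open>simp_all add: space_\<mu>\<close>)
  then obtain t where t: "t \<in> borel_measurable \<mu>" "\<And>x. x \<in> X \<Longrightarrow> t x \<in> minimizers \<psi> x"
    using hit_measurable_selection[of \<mu> "minimizers \<psi>"] space_\<mu> by metis
  then show ?thesis using that measurable_\<mu>_\<nu>I minimizer_in_Y by blast
qed

text \<open>The cost is a Borel function on the product, so its composition with a Borel map is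
  measurable.\<close>

lemma measurable_cost_along:
  assumes "t \<in> measurable \<mu> \<nu>"
  shows "(\<lambda>x. c x (t x)) \<in> borel_measurable \<mu>"
proof -
  have t: "(\<lambda>x. (x, t x)) \<in> borel_measurable \<mu>"
  proof (rule borel_measurable_Pair)
    show "(\<lambda>x. x) \<in> borel_measurable \<mu>"
      using sets_\<mu> by (simp cong: measurable_cong_sets add: measurable_restrict_space1)
  qed (rule measurable_\<mu>_\<nu>D(1)[OF assms])
  show ?thesis
    unfolding borel_measurable_iff_le
  proof
    fix a
    have "{x\<in>space \<mu>. c x (t x) \<le> a} = (\<lambda>x. (x, t x)) -` {z\<in>X \<times> Y. (\<lambda>(x, y). c x y) z \<le> a} \<inter> space \<mu>"
      using measurable_\<mu>_\<nu>D(2)[OF assms] by (auto simp: space_\<mu>)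
    also have "\<dots> \<in> sets \<mu>"
      by (intro measurable_sets[OF t] borel_closed lsc_on_closed_sublevel lsc_cost closed_Times
          compact_imp_closed compact_X compact_Y)
    finally show "{x\<in>space \<mu>. c x (t x) \<le> a} \<in> sets \<mu>" .
  qed
qed

subsection \<open>The inner infimum\<close>

lemma F_fun_eq:
  assumes "continuous_on Y \<psi>" "t \<in> measurable \<mu> \<nu>"
  shows "F_fun c \<mu> \<nu> \<psi> t
    = ext_integral \<mu> (\<lambda>x. ereal (c x (t x) - \<psi> (t x))) + ereal (\<integral>y. \<psi> y \<partial>\<nu>)"
proof -
  obtain B where B: "\<And>y. y \<in> Y \<Longrightarrow> \<bar>\<psi> y\<bar> \<le> B" using continuous_bounded_on_Y[OF assms(1)] by blast
  obtain K where K: "\<And>x y. x \<in> X \<Longrightarrow> y \<in> Y \<Longrightarrow> K \<le> c x y" using cost_lower_bound by blast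
  have "(\<integral>y. \<psi> y \<partial>(distr \<mu> \<nu> t)) = (\<integral>x. \<psi> (t x) \<partial>\<mu>)"
    by (rule integral_distr[OF assms(2) continuous_measurable_\<nu>[OF assms(1)]])
  moreover have "ext_integral \<mu> (\<lambda>x. ereal (c x (t x) - \<psi> (t x)))
      = ext_integral \<mu> (\<lambda>x. ereal (c x (t x))) - ereal (\<integral>x. \<psi> (t x) \<partial>\<mu>)"
    using K B measurable_\<mu>_\<nu>D(2)[OF assms(2)] integrable_\<mu>_continuous_comp[OF assms]
    by (intro ext_integral_diff[where K = K and L = B] \<mu>.finite_measure_axioms measurable_cost_along assms)
      (auto simp: space_\<mu>)
  ultimately show ?thesis
    unfolding F_fun_def
    by (cases "ext_integral \<mu> (\<lambda>x. ereal (c x (t x)))") auto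
qed

lemma dual_fun_eq:
  assumes "continuous_on Y \<psi>"
  shows "dual_fun c Y \<mu> \<nu> \<psi> = ext_integral \<mu> (\<lambda>x. ereal (ctr \<psi> x)) + ereal (\<integral>y. \<psi> y \<partial>\<nu>)"
  unfolding dual_fun_def
  by (intro arg_cong2[where f = "(+)"] ext_integral_cong) (simp_all add: ctrans_Y_eq_ctr[OF assms] space_\<mu>)

lemma dual_fun_le_F_fun:
  assumes "continuous_on Y \<psi>" "t \<in> measurable \<mu> \<nu>"
  shows "dual_fun c Y \<mu> \<nu> \<psi> \<le> F_fun c \<mu> \<nu> \<psi> t"
  unfolding F_fun_eq[OF assms] dual_fun_eq[OF assms(1)]
  by (intro add_right_mono ext_integral_mono)
    (use ctr_le[OF assms(1)] measurable_\<mu>_\<nu>D(2)[OF assms(2)] in \<open>simp add: space_\<mu>\<close>)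

lemma F_fun_minimizing_map:
  assumes "continuous_on Y \<psi>" "t \<in> measurable \<mu> \<nu>" "\<And>x. x \<in> X \<Longrightarrow> t x \<in> minimizers \<psi> x"
  shows "F_fun c \<mu> \<nu> \<psi> t = dual_fun c Y \<mu> \<nu> \<psi>"
  unfolding F_fun_eq[OF assms(1,2)] dual_fun_eq[OF assms(1)]
  by (intro arg_cong2[where f = "(+)"] ext_integral_cong) (simp_all add: ctr_eq_minimizer[OF assms(3)] space_\<mu>)

text \<open>A measurable selection of minimisers attains the pointwise lower bound \<open>\<psi>\<^sup>c\<close> of the integrand.\<close>

lemma INF_F_fun_eq_dual_fun:
  assumes "continuous_on Y \<psi>"
  shows "(INF t\<in>measurable \<mu> \<nu>. F_fun c \<mu> \<nu> \<psi> t) = dual_fun c Y \<mu> \<nu> \<psi>"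
proof -
  obtain t where "t \<in> measurable \<mu> \<nu>" "\<And>x. x \<in> X \<Longrightarrow> t x \<in> minimizers \<psi> x"
    using minimizing_map[OF assms] by blast
  then show ?thesis
    using dual_fun_le_F_fun[OF assms] F_fun_minimizing_map[OF assms]
    by (intro antisym INF_greatest) (auto intro: INF_lower2)
qed

lemma SUP_dual_fun_eq_kantorovich_dual:
  "(SUP \<psi>\<in>{\<psi>. continuous_on Y \<psi>}. dual_fun c Y \<mu> \<nu> \<psi>) = kantorovich_dual c X Y \<mu> \<nu>"
proof (rule antisym)
  show "(SUP \<psi>\<in>{\<psi>. continuous_on Y \<psi>}. dual_fun c Y \<mu> \<nu> \<psi>) \<le> kantorovich_dual c X Y \<mu> \<nu>"
  proof (rule SUP_least)
    fix \<psi> assume "\<psi> \<in> {\<psi> :: 'b \<Rightarrow> real. continuous_on Y \<psi>}"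
    then have \<psi>: "continuous_on Y \<psi>" by simp
    have "ext_integral \<mu> (\<lambda>x. ereal (ctr \<psi> x)) \<le> kantorovich_dual c X Y \<mu> \<nu> - ereal (\<integral>y. \<psi> y \<partial>\<nu>)"
    proof (rule ext_integral_le_if_continuous_below[OF \<mu>.finite_measure_axioms space_\<mu> sets_\<mu> compact_X X_nonempty
          lsc_on_ctr[OF \<psi>] measurable_ctr[OF \<psi>]])
      fix \<phi> assume \<phi>: "continuous_on X \<phi>" "\<And>x. x \<in> X \<Longrightarrow> \<phi> x \<le> ctr \<psi> x"
      have "\<phi> x + \<psi> y \<le> c x y" if "x \<in> X" "y \<in> Y" for x y
        using \<phi>(2)[OF that(1)] ctr_le[OF \<psi> that] by simp
      then have "ereal ((\<integral>x. \<phi> x \<partial>\<mu>) + (\<integral>y. \<psi> y \<partial>\<nu>)) \<le> kantorovich_dual c X Y \<mu> \<nu>"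
        unfolding kantorovich_dual_def using \<phi>(1) \<psi> by (intro SUP_upper2[of "(\<phi>, \<psi>)"]) auto
      then show "ereal (\<integral>x. \<phi> x \<partial>\<mu>) \<le> kantorovich_dual c X Y \<mu> \<nu> - ereal (\<integral>y. \<psi> y \<partial>\<nu>)"
        by (simp add: ereal_le_minus)
    qed
    then show "dual_fun c Y \<mu> \<nu> \<psi> \<le> kantorovich_dual c X Y \<mu> \<nu>"
      by (simp add: dual_fun_eq[OF \<psi>] ereal_le_minus)
  qed
  show "kantorovich_dual c X Y \<mu> \<nu> \<le> (SUP \<psi>\<in>{\<psi>. continuous_on Y \<psi>}. dual_fun c Y \<mu> \<nu> \<psi>)"
    unfolding kantorovich_dual_def
  proof (rule SUP_least, clarify)
    fix \<phi> :: "'a \<Rightarrow> real" and \<psi> :: "'b \<Rightarrow> real"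
    assume \<phi>: "continuous_on X \<phi>" and \<psi>: "continuous_on Y \<psi>"
      and le: "\<forall>x\<in>X. \<forall>y\<in>Y. \<phi> x + \<psi> y \<le> c x y"
    have meas: "\<phi> \<in> borel_measurable \<mu>"
      by (intro measurable_from_sublevels lsc_on_closed_sublevel continuous_on_imp_lsc_on \<phi>
          compact_imp_closed compact_X)
    obtain B where B: "\<And>x. x \<in> X \<Longrightarrow> \<bar>\<phi> x\<bar> \<le> B"
      using compact_imp_bounded[OF compact_continuous_image[OF \<phi> compact_X]] by (auto simp: bounded_iff)
    have "integrable \<mu> \<phi>"
      by (rule \<mu>.integrable_const_bound[of _ B]) (use B meas in \<open>auto simp: space_\<mu>\<close>)
    moreover have "- B \<le> \<phi> x" if "x \<in> space \<mu>" for x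
      using B[of x] that by (simp add: space_\<mu> abs_le_iff)
    ultimately have "ereal (\<integral>x. \<phi> x \<partial>\<mu>) = ext_integral \<mu> (\<lambda>x. ereal (\<phi> x))"
      using ext_integral_ereal[OF \<mu>.finite_measure_axioms meas, of "- B"] by simp
    also have "\<dots> \<le> ext_integral \<mu> (\<lambda>x. ereal (ctr \<psi> x))"
      by (rule ext_integral_mono) (use le in \<open>auto simp: space_\<mu> le_diff_eq intro!: ctr_greatest\<close>)
    finally have "ereal ((\<integral>x. \<phi> x \<partial>\<mu>) + (\<integral>y. \<psi> y \<partial>\<nu>)) \<le> dual_fun c Y \<mu> \<nu> \<psi>"
      unfolding dual_fun_eq[OF \<psi>] plus_ereal.simps(1)[symmetric] by (rule add_right_mono)
    then show "ereal ((\<integral>x. \<phi> x \<partial>\<mu>) + (\<integral>y. \<psi> y \<partial>\<nu>))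
        \<le> (SUP \<psi>\<in>{\<psi>. continuous_on Y \<psi>}. dual_fun c Y \<mu> \<nu> \<psi>)"
      using \<psi> by (intro SUP_upper2[of \<psi>]) auto
  qed
qed

end

context transport
begin

subsection \<open>The double c-transform\<close>

definition cctr :: "('b \<Rightarrow> real) \<Rightarrow> 'b \<Rightarrow> real" where
  "cctr \<psi> y = (INF x\<in>X. c x y - ctr \<psi> x)"

context
  fixes \<psi> :: "'b \<Rightarrow> real"
  assumes \<psi>: "continuous_on Y \<psi>"
begin

lemma cctr_bdd_below: "y \<in> Y \<Longrightarrow> bdd_below ((\<lambda>x. c x y - ctr \<psi> x) ` X)"
  using ctr_le[OF \<psi>] by (intro bdd_belowI2[of _ "\<psi> y"]) (simp add: algebra_simps)

lemma le_cctr: "y \<in> Y \<Longrightarrow> \<psi> y \<le> cctr \<psi> y"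
  unfolding cctr_def using ctr_le[OF \<psi>] by (intro cINF_greatest X_nonempty) (simp add: algebra_simps)

lemma cctr_le: "x \<in> X \<Longrightarrow> y \<in> Y \<Longrightarrow> cctr \<psi> y \<le> c x y - ctr \<psi> x"
  unfolding cctr_def by (intro cINF_lower cctr_bdd_below)

lemma cc_trans_eq_cctr:
  assumes "y \<in> Y"
  shows "cc_trans c X Y (\<lambda>y. ereal (\<psi> y)) y = ereal (cctr \<psi> y)"
proof -
  have "cc_trans c X Y (\<lambda>y. ereal (\<psi> y)) y = (INF x\<in>X. ereal (c x y - ctr \<psi> x))"
    unfolding cc_trans_def ctrans_X_def by (intro INF_cong refl) (simp add: ctrans_Y_eq_ctr[OF \<psi>])
  also have "\<dots> = ereal (cctr \<psi> y)"
    using ereal_Inf'[OF cctr_bdd_below[OF assms]] X_nonempty by (simp add: cctr_def image_image)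
  finally show ?thesis .
qed

text \<open>The strict sublevel sets of the double transform are countable unions of compact sets: with a
  rational \<open>r\<close> between \<open>c x y\<close> and \<open>a + ctr \<psi> x\<close>, the condition splits into a closed one on \<open>(x, y)\<close>
  and an open one on \<open>x\<close>, and projections of countable unions of compact sets are again such unions.\<close>

lemma measurable_cctr: "cctr \<psi> \<in> borel_measurable \<nu>"
  unfolding borel_measurable_iff_less
proof
  fix a
  define L where "L = (\<lambda>r. {z\<in>X \<times> Y. (\<lambda>(x, y). c x y) z \<le> r})"
  define E where "E = (\<lambda>r. L r \<inter> (- {x\<in>X. ctr \<psi> x \<le> r - a}) \<times> UNIV)"
  have E: "snd ` E r \<in> sets \<nu>" for r
  proof -
    have op: "open (- {x\<in>X. ctr \<psi> x \<le> r - a})"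
      by (intro open_Compl lsc_on_closed_sublevel compact_imp_closed compact_X lsc_on_ctr \<psi>)
    obtain K :: "nat \<Rightarrow> 'a set" where K: "\<And>n. compact (K n)" "(\<Union>n. K n) = - {x\<in>X. ctr \<psi> x \<le> r - a}"
      by (rule open_Union_compact_subsets[OF op]) (rule that, simp_all)
    have "L r \<inter> (\<Union>n. K n) \<times> UNIV = (\<Union>n. L r \<inter> K n \<times> UNIV)"
      by blast
    then have *: "snd ` E r = (\<Union>n. snd ` (L r \<inter> K n \<times> UNIV))"
      by (simp only: E_def K(2) image_UN)
    have "compact (snd ` (L r \<inter> K n \<times> UNIV))" for n
      unfolding L_def
      by (intro compact_continuous_image continuous_intros compact_Int_closed lsc_on_compact_sublevel
          compact_Times compact_X compact_Y lsc_cost closed_Times compact_imp_closed[OF K(1)] closed_UNIV)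
    moreover have "snd ` (L r \<inter> K n \<times> UNIV) \<subseteq> Y" for n
      by (auto simp: L_def)
    ultimately show ?thesis
      unfolding * by (intro sets.countable_UN'' closed_sets_\<nu> compact_imp_closed) simp_all
  qed
  have "{y\<in>space \<nu>. cctr \<psi> y < a} = (\<Union>r\<in>\<rat>. snd ` E r)"
  proof (intro equalityI subsetI)
    fix y assume "y \<in> {y\<in>space \<nu>. cctr \<psi> y < a}"
    then have y: "y \<in> Y" and "cctr \<psi> y < a" by (simp_all add: space_\<nu>)
    then obtain x where x: "x \<in> X" "c x y - ctr \<psi> x < a"
      unfolding cctr_def using cINF_less_iff[OF X_nonempty cctr_bdd_below] by blast
    then have "c x y < a + ctr \<psi> x" by simp
    then obtain r where r: "r \<in> \<rat>" "c x y < r" "r < a + ctr \<psi> x"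
      using Rats_dense_in_real by blast
    then have "(x, y) \<in> E r" using x y by (auto simp: E_def L_def)
    then show "y \<in> (\<Union>r\<in>\<rat>. snd ` E r)" using r(1) by force
  next
    fix y assume "y \<in> (\<Union>r\<in>\<rat>. snd ` E r)"
    then obtain r z where "z \<in> E r" "y = snd z" by blast
    then obtain x where "(x, y) \<in> E r" by (cases z) simp
    then have "x \<in> X" "y \<in> Y" "c x y \<le> r" "\<not> ctr \<psi> x \<le> r - a"
      by (auto simp: E_def L_def)
    then show "y \<in> {y\<in>space \<nu>. cctr \<psi> y < a}"
      using cctr_le[of x y] by (simp add: space_\<nu>)
  qed
  also have "\<dots> \<in> sets \<nu>"
    by (intro sets.countable_UN'' countable_rat E)
  finally show "{y\<in>space \<nu>. cctr \<psi> y < a} \<in> sets \<nu>" .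
qed

lemma F_fun_ext_eq:
  assumes "t \<in> measurable \<mu> \<nu>"
  shows "F_fun_ext c \<mu> \<nu> (cc_trans c X Y (\<lambda>y. ereal (\<psi> y))) t
    = ext_integral \<mu> (\<lambda>x. ereal (c x (t x) - cctr \<psi> (t x))) + ext_integral \<nu> (\<lambda>y. ereal (cctr \<psi> y))"
  unfolding F_fun_ext_def
  by (intro arg_cong2[where f = "(+)"] ext_integral_cong)
    (use measurable_\<mu>_\<nu>D(2)[OF assms] in \<open>simp_all add: space_\<mu> space_\<nu> cc_trans_eq_cctr\<close>)

lemma ext_integral_potential: "ext_integral \<nu> (\<lambda>y. ereal (\<psi> y)) = ereal (\<integral>y. \<psi> y \<partial>\<nu>)"
proof -
  obtain B where "\<And>y. y \<in> Y \<Longrightarrow> \<bar>\<psi> y\<bar> \<le> B" using continuous_bounded_on_Y[OF \<psi>] by blast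
  then have "- B \<le> \<psi> y" if "y \<in> space \<nu>" for y using that by (force simp: space_\<nu> abs_le_iff)
  then show ?thesis
    using ext_integral_ereal[OF \<nu>.finite_measure_axioms continuous_measurable_\<nu>[OF \<psi>], of "- B"]
      integrable_\<nu>_continuous[OF \<psi>] by simp
qed

lemma INF_F_fun_ext_ge:
  "ext_integral \<mu> (\<lambda>x. ereal (ctr \<psi> x)) + ext_integral \<nu> (\<lambda>y. ereal (cctr \<psi> y))
    \<le> (INF t\<in>measurable \<mu> \<nu>. F_fun_ext c \<mu> \<nu> (cc_trans c X Y (\<lambda>y. ereal (\<psi> y))) t)"
proof (rule INF_greatest)
  fix t assume t: "t \<in> measurable \<mu> \<nu>"
  show "ext_integral \<mu> (\<lambda>x. ereal (ctr \<psi> x)) + ext_integral \<nu> (\<lambda>y. ereal (cctr \<psi> y))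
    \<le> F_fun_ext c \<mu> \<nu> (cc_trans c X Y (\<lambda>y. ereal (\<psi> y))) t"
    unfolding F_fun_ext_eq[OF t]
    by (intro add_right_mono ext_integral_mono)
      (use cctr_le measurable_\<mu>_\<nu>D(2)[OF t] in \<open>force simp: space_\<mu> algebra_simps\<close>)
qed

lemma dual_fun_le_cc:
  "dual_fun c Y \<mu> \<nu> \<psi>
    \<le> ext_integral \<mu> (\<lambda>x. ereal (ctr \<psi> x)) + ext_integral \<nu> (\<lambda>y. ereal (cctr \<psi> y))"
  unfolding dual_fun_eq[OF \<psi>] ext_integral_potential[symmetric]
  by (intro add_left_mono ext_integral_mono) (simp add: space_\<nu> le_cctr)

lemma INF_F_fun_le_cc:
  "(INF t\<in>measurable \<mu> \<nu>. F_fun c \<mu> \<nu> \<psi> t)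
    \<le> (INF t\<in>measurable \<mu> \<nu>. F_fun_ext c \<mu> \<nu> (cc_trans c X Y (\<lambda>y. ereal (\<psi> y))) t)"
  unfolding INF_F_fun_eq_dual_fun[OF \<psi>] by (rule order_trans[OF dual_fun_le_cc INF_F_fun_ext_ge])

lemma ext_integral_ctr_gt_MInf: "ext_integral \<mu> (\<lambda>x. ereal (ctr \<psi> x)) \<noteq> - \<infinity>"
proof -
  obtain K where "\<And>x. x \<in> X \<Longrightarrow> K \<le> ctr \<psi> x" using ctr_lower_bound[OF \<psi>] by blast
  then show ?thesis
    using ext_integral_ereal[OF \<mu>.finite_measure_axioms measurable_ctr[OF \<psi>], of K] by (simp add: space_\<mu>)
qed

text \<open>If \<open>\<psi> = \<phi>\<^sup>c\<close> then \<open>\<phi> \<le> \<psi>\<^sup>c\<close>, so that \<open>\<psi>\<^sup>c\<^sup>c \<le> \<phi>\<^sup>c = \<psi>\<close>.\<close>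

lemma cctr_eq_if_c_concave:
  assumes "c_concave_on_Y c X Y (\<lambda>y. ereal (\<psi> y))" "y \<in> Y"
  shows "cctr \<psi> y = \<psi> y"
proof (rule antisym[OF _ le_cctr[OF assms(2)]])
  obtain \<phi> where \<phi>: "\<And>y. y \<in> Y \<Longrightarrow> ereal (\<psi> y) = (INF x\<in>X. ereal (c x y) - \<phi> x)"
    using assms(1) by (auto simp: c_concave_on_Y_def ctrans_X_def)
  have le: "\<phi> x \<le> ereal (ctr \<psi> x)" if x: "x \<in> X" for x
  proof -
    obtain z where z: "z \<in> minimizers \<psi> x" using minimizers_nonempty[OF \<psi> x] by blast
    have "ereal (\<psi> z) \<le> ereal (c x z) - \<phi> x"
      unfolding \<phi>[OF minimizer_in_Y[OF z]] by (rule INF_lower[OF x])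
    then show ?thesis
      unfolding ctr_eq_minimizer[OF z] by (cases "\<phi> x") auto
  qed
  have "ereal (cctr \<psi> y) \<le> (INF x\<in>X. ereal (c x y) - \<phi> x)"
  proof (rule INF_greatest)
    fix x assume x: "x \<in> X"
    show "ereal (cctr \<psi> y) \<le> ereal (c x y) - \<phi> x"
      using cctr_le[OF x assms(2)] le[OF x] by (cases "\<phi> x") auto
  qed
  then show "cctr \<psi> y \<le> \<psi> y" by (simp flip: \<phi>[OF assms(2)])
qed

lemma INF_F_fun_eq_cc_if_c_concave:
  assumes "c_concave_on_Y c X Y (\<lambda>y. ereal (\<psi> y))"
  shows "(INF t\<in>measurable \<mu> \<nu>. F_fun c \<mu> \<nu> \<psi> t)
    = (INF t\<in>measurable \<mu> \<nu>. F_fun_ext c \<mu> \<nu> (cc_trans c X Y (\<lambda>y. ereal (\<psi> y))) t)"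
proof (rule INF_cong[OF refl])
  fix t assume t: "t \<in> measurable \<mu> \<nu>"
  show "F_fun c \<mu> \<nu> \<psi> t = F_fun_ext c \<mu> \<nu> (cc_trans c X Y (\<lambda>y. ereal (\<psi> y))) t"
    unfolding F_fun_ext_eq[OF t] F_fun_eq[OF \<psi> t] ext_integral_potential[symmetric]
    by (intro arg_cong2[where f = "(+)"] ext_integral_cong)
      (use measurable_\<mu>_\<nu>D(2)[OF t] in \<open>simp_all add: space_\<mu> space_\<nu> cctr_eq_if_c_concave[OF assms]\<close>)
qed

text \<open>The infimum at \<open>\<psi>\<^sup>c\<^sup>c\<close> is at least \<open>\<integral>\<psi>\<^sup>c d\<mu> + \<integral>\<psi>\<^sup>c\<^sup>c d\<nu>\<close>. Finiteness allows cancelling the first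
  integral, and equality of the infima then forces \<open>\<psi>\<close> and the larger function \<open>\<psi>\<^sup>c\<^sup>c\<close> to have the same integral.\<close>

lemma AE_eq_cc_if_INF_F_fun_eq:
  assumes eq: "(INF t\<in>measurable \<mu> \<nu>. F_fun c \<mu> \<nu> \<psi> t)
    = (INF t\<in>measurable \<mu> \<nu>. F_fun_ext c \<mu> \<nu> (cc_trans c X Y (\<lambda>y. ereal (\<psi> y))) t)"
    and fin: "(INF t\<in>measurable \<mu> \<nu>. F_fun c \<mu> \<nu> \<psi> t) < \<infinity>"
  shows "AE y in \<nu>. \<psi> y = cctr \<psi> y"
proof -
  obtain B where B: "\<And>y. y \<in> Y \<Longrightarrow> \<bar>\<psi> y\<bar> \<le> B" using continuous_bounded_on_Y[OF \<psi>] by blast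
  let ?i = "ext_integral \<mu> (\<lambda>x. ereal (ctr \<psi> x))"
  have "?i + ext_integral \<nu> (\<lambda>y. ereal (cctr \<psi> y)) \<le> ?i + ext_integral \<nu> (\<lambda>y. ereal (\<psi> y))"
    using INF_F_fun_ext_ge eq INF_F_fun_eq_dual_fun[OF \<psi>] dual_fun_eq[OF \<psi>]
    by (simp add: ext_integral_potential)
  moreover have "?i \<noteq> \<infinity>"
    using fin INF_F_fun_eq_dual_fun[OF \<psi>] dual_fun_eq[OF \<psi>] by auto
  ultimately have le: "ext_integral \<nu> (\<lambda>y. ereal (cctr \<psi> y)) \<le> ext_integral \<nu> (\<lambda>y. ereal (\<psi> y))"
    using ext_integral_ctr_gt_MInf by (cases ?i) (simp_all add: ereal_add_le_add_iff)
  show ?thesis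
  proof (rule AE_eq_if_ext_integral_eq[where K = "- B"])
    show "ext_integral \<nu> (\<lambda>y. ereal (\<psi> y)) = ext_integral \<nu> (\<lambda>y. ereal (cctr \<psi> y))"
      by (intro antisym le ext_integral_mono) (simp add: space_\<nu> le_cctr)
    show "- B \<le> \<psi> y" if "y \<in> space \<nu>" for y
      using B[of y] that by (simp add: space_\<nu> abs_le_iff)
  qed (simp_all add: \<nu>.finite_measure_axioms continuous_measurable_\<nu>[OF \<psi>] measurable_cctr le_cctr space_\<nu>
      ext_integral_potential)
qed

end

subsection \<open>The outer supremum for a map that misses the target\<close>

text \<open>Some continuous function has different integrals against the two measures. Its multiples
  make the second term of \<open>F\<close> arbitrarily large, while the first one is bounded below.\<close>

lemma SUP_F_fun_eq_infinity:
  assumes t: "t \<in> measurable \<mu> \<nu>" and ne: "distr \<mu> \<nu> t \<noteq> \<nu>"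
  shows "(SUP \<psi>\<in>{\<psi>. continuous_on Y \<psi>}. F_fun c \<mu> \<nu> \<psi> t) = \<infinity>"
proof -
  interpret t: prob_space "distr \<mu> \<nu> t" by (rule \<mu>.prob_space_distr[OF t])
  obtain \<psi> :: "'b \<Rightarrow> real" where \<psi>: "continuous_on Y \<psi>" "(\<integral>y. \<psi> y \<partial>(distr \<mu> \<nu> t)) \<noteq> (\<integral>y. \<psi> y \<partial>\<nu>)"
    using continuous_integrals_determine_measure[OF t.finite_measure_axioms \<nu>.finite_measure_axioms _ sets_\<nu> compact_Y]
      ne sets_\<nu> by (metis sets_distr)
  define d where "d = (\<integral>y. \<psi> y \<partial>\<nu>) - (\<integral>y. \<psi> y \<partial>(distr \<mu> \<nu> t))"
  have d: "d \<noteq> 0" using \<psi>(2) by (simp add: d_def)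
  obtain K where K: "\<And>x y. x \<in> X \<Longrightarrow> y \<in> Y \<Longrightarrow> K \<le> c x y" using cost_lower_bound by blast
  have "\<exists>\<psi>\<in>{\<psi>. continuous_on Y \<psi>}. ereal (real n) \<le> F_fun c \<mu> \<nu> \<psi> t" for n
  proof
    \<comment> \<open>The second term of \<open>F\<close> becomes \<open>n - K\<close>, where \<open>K\<close> bounds the first one below.\<close>
    define k where "k = (real n - K) / d"
    have eq: "F_fun c \<mu> \<nu> (\<lambda>y. k * \<psi> y) t = ext_integral \<mu> (\<lambda>x. ereal (c x (t x))) + ereal (real n - K)"
    proof -
      have "k * d = real n - K" using d by (simp add: k_def)
      then have "k * (\<integral>y. \<psi> y \<partial>\<nu>) - k * (\<integral>y. \<psi> y \<partial>(distr \<mu> \<nu> t)) = real n - K"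
        by (simp add: d_def right_diff_distrib)
      then show ?thesis by (simp add: F_fun_def)
    qed
    have "ereal K \<le> ext_integral \<mu> (\<lambda>x. ereal (c x (t x)))"
    proof -
      have "ereal K = ext_integral \<mu> (\<lambda>x. ereal K)"
        using ext_integral_ereal[OF \<mu>.finite_measure_axioms, of "\<lambda>_. K" K] by (simp add: \<mu>.prob_space)
      also have "\<dots> \<le> ext_integral \<mu> (\<lambda>x. ereal (c x (t x)))"
        by (rule ext_integral_mono) (use K measurable_\<mu>_\<nu>D(2)[OF t] in \<open>simp add: space_\<mu>\<close>)
      finally show ?thesis .
    qed
    then show "ereal (real n) \<le> F_fun c \<mu> \<nu> (\<lambda>y. k * \<psi> y) t"
      unfolding eq by (cases "ext_integral \<mu> (\<lambda>x. ereal (c x (t x)))") auto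
    show "(\<lambda>y. k * \<psi> y) \<in> {\<psi>. continuous_on Y \<psi>}"
      using \<psi>(1) by (simp add: continuous_intros)
  qed
  then show ?thesis by (rule SUP_PInfty)
qed

end

section \<open>Continuous costs\<close>

locale continuous_transport = transport +
  assumes continuous_cost: "continuous_on (X \<times> Y) (\<lambda>(x, y). c x y)"
begin

lemma cost_bound:
  obtains C where "\<And>x y. x \<in> X \<Longrightarrow> y \<in> Y \<Longrightarrow> \<bar>c x y\<bar> \<le> C"
proof -
  obtain C where "\<forall>z\<in>(\<lambda>(x, y). c x y) ` (X \<times> Y). norm z \<le> C"
    using compact_imp_bounded[OF compact_continuous_image[OF continuous_cost compact_Times[OF compact_X compact_Y]]]
    by (auto simp: bounded_iff)
  then show ?thesis by (intro that[of C]) auto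
qed

lemma cost_equicontinuous:
  assumes "e > 0"
  obtains d where "d > 0"
    "\<And>x y y'. \<lbrakk>x \<in> X; y \<in> Y; y' \<in> Y; dist y y' < d\<rbrakk> \<Longrightarrow> c x y \<le> c x y' + e"
proof -
  have "uniformly_continuous_on (X \<times> Y) (\<lambda>(x, y). c x y)"
    by (intro compact_uniformly_continuous continuous_cost compact_Times compact_X compact_Y)
  then obtain d where d: "d > 0" "\<And>z z'. \<lbrakk>z \<in> X \<times> Y; z' \<in> X \<times> Y; dist z' z < d\<rbrakk>
      \<Longrightarrow> dist ((\<lambda>(x, y). c x y) z') ((\<lambda>(x, y). c x y) z) < e"
    unfolding uniformly_continuous_on_def using assms by metis
  have "c x y \<le> c x y' + e" if "x \<in> X" "y \<in> Y" "y' \<in> Y" "dist y y' < d" for x y y'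
    using d(2)[of "(x, y')" "(x, y)"] that by (simp add: dist_Pair_Pair dist_real_def)
  then show ?thesis using that d(1) by blast
qed

lemma cctr_le_add:
  assumes "continuous_on Y \<psi>" "y \<in> Y" "y' \<in> Y" "\<And>x. x \<in> X \<Longrightarrow> c x y \<le> c x y' + e"
  shows "cctr \<psi> y \<le> cctr \<psi> y' + e"
proof -
  have "cctr \<psi> y - e \<le> cctr \<psi> y'"
    unfolding cctr_def[of \<psi> y']
  proof (rule cINF_greatest[OF X_nonempty])
    fix x assume "x \<in> X"
    then show "cctr \<psi> y - e \<le> c x y' - ctr \<psi> x"
      using cctr_le[OF assms(1) _ assms(2), of x] assms(4)[of x] by simp
  qed
  then show ?thesis by simp
qed

lemma continuous_on_cctr:
  assumes "continuous_on Y \<psi>"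
  shows "continuous_on Y (cctr \<psi>)"
  unfolding continuous_on_iff
proof (intro ballI allI impI)
  fix y and e :: real assume y: "y \<in> Y" and e: "e > 0"
  obtain d where d: "d > 0"
    "\<And>x y y'. \<lbrakk>x \<in> X; y \<in> Y; y' \<in> Y; dist y y' < d\<rbrakk> \<Longrightarrow> c x y \<le> c x y' + e / 2"
    using cost_equicontinuous[of "e / 2"] e by auto
  have "dist (cctr \<psi> y') (cctr \<psi> y) < e" if "y' \<in> Y" "dist y' y < d" for y'
    using cctr_le_add[OF assms that(1) y d(2)[OF _ that(1) y that(2)]]
      cctr_le_add[OF assms y that(1) d(2)[OF _ y that(1)]] that(2) e
    by (auto simp: dist_real_def dist_commute abs_le_iff)
  then show "\<exists>d>0. \<forall>y'\<in>Y. dist y' y < d \<longrightarrow> dist (cctr \<psi> y') (cctr \<psi> y) < e"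
    using d(1) by blast
qed

lemma integrable_ctr:
  assumes \<psi>: "continuous_on Y \<psi>"
  shows "integrable \<mu> (ctr \<psi>)"
proof -
  obtain K where K: "\<And>x. x \<in> X \<Longrightarrow> K \<le> ctr \<psi> x" using ctr_lower_bound[OF \<psi>] by blast
  obtain y where y: "y \<in> Y" using Y_nonempty by blast
  obtain C where C: "\<And>x y. x \<in> X \<Longrightarrow> y \<in> Y \<Longrightarrow> \<bar>c x y\<bar> \<le> C" using cost_bound by blast
  have "ctr \<psi> x \<le> C - \<psi> y" if "x \<in> X" for x
    using ctr_le[OF \<psi> that y] C[OF that y] by (simp add: abs_le_iff)
  then have "norm (ctr \<psi> x) \<le> \<bar>K\<bar> + \<bar>C - \<psi> y\<bar>" if "x \<in> X" for x
    using K[OF that] that by (fastforce simp: abs_le_iff)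
  then show ?thesis
    by (intro \<mu>.integrable_const_bound[OF AE_I2 measurable_ctr[OF \<psi>]]) (auto simp: space_\<mu>)
qed

definition dual_value :: "('b \<Rightarrow> real) \<Rightarrow> real" where
  "dual_value \<psi> = (\<integral>x. ctr \<psi> x \<partial>\<mu>) + (\<integral>y. \<psi> y \<partial>\<nu>)"

lemma dual_fun_eq_dual_value:
  assumes \<psi>: "continuous_on Y \<psi>"
  shows "dual_fun c Y \<mu> \<nu> \<psi> = ereal (dual_value \<psi>)"
proof -
  obtain K where K: "\<And>x. x \<in> X \<Longrightarrow> K \<le> ctr \<psi> x" using ctr_lower_bound[OF \<psi>] by blast
  then show ?thesis
    using ext_integral_ereal[OF \<mu>.finite_measure_axioms measurable_ctr[OF \<psi>], of K] integrable_ctr[OF \<psi>]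
    by (simp add: dual_fun_eq[OF \<psi>] dual_value_def space_\<mu>)
qed

text \<open>For a continuous cost \<open>\<psi>\<^sup>c\<^sup>c\<close> is continuous, so it differs from \<open>\<psi>\<close> on a relatively open set; that
  set is null, hence empty when \<open>\<nu>\<close> has full support.\<close>

lemma c_concave_if_INF_F_fun_eq:
  assumes \<psi>: "continuous_on Y \<psi>"
    and supp: "\<And>U. open U \<Longrightarrow> U \<inter> Y \<noteq> {} \<Longrightarrow> emeasure \<nu> (U \<inter> Y) > 0"
    and eq: "(INF t\<in>measurable \<mu> \<nu>. F_fun c \<mu> \<nu> \<psi> t)
      = (INF t\<in>measurable \<mu> \<nu>. F_fun_ext c \<mu> \<nu> (cc_trans c X Y (\<lambda>y. ereal (\<psi> y))) t)"
  shows "c_concave_on_Y c X Y (\<lambda>y. ereal (\<psi> y))"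
proof -
  have "(INF t\<in>measurable \<mu> \<nu>. F_fun c \<mu> \<nu> \<psi> t) < \<infinity>"
    using INF_F_fun_eq_dual_fun[OF \<psi>] by (simp add: dual_fun_eq_dual_value[OF \<psi>])
  then have ae: "AE y in \<nu>. \<psi> y = cctr \<psi> y"
    using AE_eq_cc_if_INF_F_fun_eq[OF \<psi> eq] by simp
  have "openin (top_of_set Y) (Y \<inter> (\<lambda>y. cctr \<psi> y - \<psi> y) -` {0<..})"
    by (intro continuous_openin_preimage_gen continuous_intros continuous_on_cctr \<psi> open_greaterThan)
  then obtain U where U: "open U" "Y \<inter> (\<lambda>y. cctr \<psi> y - \<psi> y) -` {0<..} = U \<inter> Y"
    unfolding openin_open by (auto simp: Int_commute)
  have "U \<inter> Y \<in> sets \<nu>"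
    using U(1) sets_restrict_space[of borel Y] by (auto simp: sets_\<nu> Int_commute)
  moreover have "AE y in \<nu>. y \<notin> U \<inter> Y"
    using ae by eventually_elim (auto simp: U(2)[symmetric])
  ultimately have "emeasure \<nu> (U \<inter> Y) = 0"
    by (intro null_setsD1 AE_iff_null_sets[THEN iffD2])
  then have "U \<inter> Y = {}" using supp[OF U(1)] by force
  then have "\<psi> y = cctr \<psi> y" if "y \<in> Y" for y
    using U(2) le_cctr[OF \<psi> that] that by fastforce
  then show ?thesis
    using cc_trans_eq_cctr[OF \<psi>] unfolding c_concave_on_Y_def cc_trans_def by metis
qed

section \<open>Existence of an optimal potential\<close>

lemma dual_value_le_add:
  assumes "continuous_on Y \<psi>" "continuous_on Y \<theta>"
    and "\<And>x. x \<in> X \<Longrightarrow> ctr \<psi> x \<le> ctr \<theta> x + a" "\<And>y. y \<in> Y \<Longrightarrow> \<psi> y \<le> \<theta> y + b"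
  shows "dual_value \<psi> \<le> dual_value \<theta> + a + b"
proof -
  have "(\<integral>x. ctr \<psi> x \<partial>\<mu>) \<le> (\<integral>x. ctr \<theta> x + a \<partial>\<mu>)"
    by (intro integral_mono Bochner_Integration.integrable_add integrable_ctr assms) (simp_all add: assms space_\<mu>)
  moreover have "(\<integral>y. \<psi> y \<partial>\<nu>) \<le> (\<integral>y. \<theta> y + b \<partial>\<nu>)"
    by (intro integral_mono Bochner_Integration.integrable_add integrable_\<nu>_continuous assms) (simp_all add: assms space_\<nu>)
  ultimately show ?thesis
    using assms(1,2)
    by (simp add: dual_value_def integrable_ctr integrable_\<nu>_continuous \<mu>.prob_space \<nu>.prob_space)
qed

text \<open>Integrate \<open>\<psi>\<^sup>c x + \<psi> y \<le> c x y\<close> over both variables.\<close>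

lemma dual_value_bdd_above: "bdd_above (dual_value ` {\<psi>. continuous_on Y \<psi>})"
proof -
  obtain C where C: "\<And>x y. x \<in> X \<Longrightarrow> y \<in> Y \<Longrightarrow> \<bar>c x y\<bar> \<le> C" using cost_bound by blast
  have "dual_value \<psi> \<le> C" if \<psi>: "continuous_on Y \<psi>" for \<psi>
  proof -
    have "\<psi> y \<le> C - (\<integral>x. ctr \<psi> x \<partial>\<mu>)" if y: "y \<in> Y" for y
    proof -
      have "(\<integral>x. ctr \<psi> x \<partial>\<mu>) \<le> (\<integral>x. C - \<psi> y \<partial>\<mu>)"
      proof (rule integral_mono[OF integrable_ctr[OF \<psi>]])
        fix x assume "x \<in> space \<mu>"
        then show "ctr \<psi> x \<le> C - \<psi> y"
          using ctr_le[OF \<psi> _ y] C[OF _ y] by (fastforce simp: space_\<mu> abs_le_iff)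
      qed simp
      then show ?thesis by (simp add: \<mu>.prob_space)
    qed
    then have "(\<integral>y. \<psi> y \<partial>\<nu>) \<le> (\<integral>y. C - (\<integral>x. ctr \<psi> x \<partial>\<mu>) \<partial>\<nu>)"
      by (intro integral_mono integrable_\<nu>_continuous \<psi>) (simp_all add: space_\<nu>)
    then show ?thesis by (simp add: dual_value_def \<nu>.prob_space)
  qed
  then show ?thesis by (intro bdd_aboveI2) auto
qed

text \<open>Replacing \<open>\<psi>\<close> by its double transform and subtracting a constant does not decrease the dual
  value and puts a maximising sequence into a bounded family with the modulus of continuity of
  the cost. A uniform limit of a subsequence is a maximiser.\<close>

theorem optimal_potential_exists: "\<exists>\<psi>. optimal_potential c Y \<mu> \<nu> \<psi>"
proof -
  define s where "s = (SUP \<psi>\<in>{\<psi>. continuous_on Y \<psi>}. dual_value \<psi>)"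
  obtain y0 where y0: "y0 \<in> Y" using Y_nonempty by blast
  have "\<exists>\<psi>. continuous_on Y \<psi> \<and> s - 1 / real (Suc n) < dual_value \<psi>" for n
  proof -
    have "s - 1 / real (Suc n) < s" by simp
    then show ?thesis
      unfolding s_def by (subst (asm) less_cSUP_iff[OF _ dual_value_bdd_above]) (auto intro: continuous_on_const)
  qed
  then obtain \<psi> where \<psi>: "\<And>n. continuous_on Y (\<psi> n)" "\<And>n. s - 1 / real (Suc n) < dual_value (\<psi> n)"
    by metis
  define \<theta> where "\<theta> = (\<lambda>n y. cctr (\<psi> n) y - cctr (\<psi> n) y0)"
  have cont: "continuous_on Y (\<theta> n)" for n
    unfolding \<theta>_def by (intro continuous_intros continuous_on_cctr \<psi>)
  have \<theta>_val: "dual_value (\<psi> n) \<le> dual_value (\<theta> n)" for n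
  proof -
    define k where "k = cctr (\<psi> n) y0"
    have "ctr (\<psi> n) x \<le> ctr (\<theta> n) x + (- k)" if "x \<in> X" for x
    proof -
      have "ctr (\<psi> n) x + k \<le> ctr (\<theta> n) x"
        by (rule ctr_greatest) (use cctr_le[OF \<psi>(1) that] in \<open>force simp: \<theta>_def k_def algebra_simps\<close>)
      then show ?thesis by simp
    qed
    moreover have "\<psi> n y \<le> \<theta> n y + k" if "y \<in> Y" for y
      using le_cctr[OF \<psi>(1) that] by (simp add: \<theta>_def k_def)
    ultimately have "dual_value (\<psi> n) \<le> dual_value (\<theta> n) + (- k) + k"
      by (rule dual_value_le_add[OF \<psi>(1) cont])
    then show ?thesis by simp
  qed
  obtain C where C: "\<And>x y. x \<in> X \<Longrightarrow> y \<in> Y \<Longrightarrow> \<bar>c x y\<bar> \<le> C" using cost_bound by blast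
  have diff: "\<bar>\<theta> n y - \<theta> n y'\<bar> \<le> e"
    if "y \<in> Y" "y' \<in> Y" "\<And>x. x \<in> X \<Longrightarrow> c x y \<le> c x y' + e" "\<And>x. x \<in> X \<Longrightarrow> c x y' \<le> c x y + e" for n y y' e
    using cctr_le_add[OF \<psi>(1)[of n] that(1-3)] cctr_le_add[OF \<psi>(1)[of n] that(2,1,4)] by (simp add: \<theta>_def abs_le_iff)
  obtain g k where g: "continuous_on Y g" and k: "strict_mono (k :: nat \<Rightarrow> nat)"
    and lim: "\<And>e. 0 < e \<Longrightarrow> \<exists>N. \<forall>n y. n \<ge> N \<and> y \<in> Y \<longrightarrow> norm (\<theta> (k n) y - g y) < e"
  proof (rule Arzela_Ascoli[OF compact_Y, of \<theta> "2 * C"])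
    fix n y assume y: "y \<in> Y"
    have "c x z \<le> c x z' + 2 * C" if "x \<in> X" "z \<in> Y" "z' \<in> Y" for x z z'
      using C[OF that(1,2)] C[OF that(1,3)] by (simp add: abs_le_iff)
    then have "\<bar>\<theta> n y - \<theta> n y0\<bar> \<le> 2 * C" using diff[OF y y0] y y0 by blast
    then show "norm (\<theta> n y) \<le> 2 * C" by (simp add: \<theta>_def)
  next
    fix y and e :: real assume y: "y \<in> Y" and e: "0 < e"
    obtain d where d: "d > 0"
      "\<And>x y y'. \<lbrakk>x \<in> X; y \<in> Y; y' \<in> Y; dist y y' < d\<rbrakk> \<Longrightarrow> c x y \<le> c x y' + e / 2"
      using cost_equicontinuous[of "e / 2"] e by auto
    have "norm (\<theta> n y - \<theta> n y') < e" if "y' \<in> Y" "norm (y - y') < d" for n y'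
    proof -
      have "dist y y' < d" "dist y' y < d" using that(2) by (simp_all add: dist_norm norm_minus_commute)
      then have "\<bar>\<theta> n y - \<theta> n y'\<bar> \<le> e / 2" by (intro diff d y that(1))
      then show ?thesis using e by simp
    qed
    then show "\<exists>d>0. \<forall>n y'. y' \<in> Y \<and> norm (y - y') < d \<longrightarrow> norm (\<theta> n y - \<theta> n y') < e"
      using d(1) by blast
  qed (rule that)
  have "s \<le> dual_value g + 3 * e" if e: "e > 0" for e
  proof -
    obtain N where N: "\<And>n y. n \<ge> N \<Longrightarrow> y \<in> Y \<Longrightarrow> norm (\<theta> (k n) y - g y) < e"
      using lim[OF e] by blast
    obtain m :: nat where m: "1 / e < m" using reals_Archimedean2 by blast
    define n where "n = max N m"
    have near: "\<bar>\<theta> (k n) y - g y\<bar> \<le> e" if "y \<in> Y" for y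
      using N[of n y] that by (simp add: n_def)
    have "1 / e < real (Suc (k n))"
      using m seq_suble[OF k, of n] by (simp add: n_def)
    then have "1 / real (Suc (k n)) < e" using e by (simp add: field_simps)
    then have "s < dual_value (\<theta> (k n)) + e" using \<psi>(2)[of "k n"] \<theta>_val[of "k n"] by linarith
    also have "dual_value (\<theta> (k n)) \<le> dual_value g + e + e"
    proof (rule dual_value_le_add[OF cont g])
      fix x assume x: "x \<in> X"
      have "ctr (\<theta> (k n)) x - e \<le> ctr g x"
      proof (rule ctr_greatest)
        fix y assume "y \<in> Y"
        then show "ctr (\<theta> (k n)) x - e \<le> c x y - g y"
          using ctr_le[OF cont x, of y "k n"] near[of y] by (simp add: abs_le_iff)
      qed
      then show "ctr (\<theta> (k n)) x \<le> ctr g x + e" by simp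
    next
      fix y assume "y \<in> Y"
      then show "\<theta> (k n) y \<le> g y + e" using near[of y] by (simp add: abs_le_iff)
    qed
    finally show ?thesis by simp
  qed
  then have "s \<le> dual_value g + e" if "e > 0" for e
    using that[THEN divide_pos_pos, of 3] by fastforce
  then have "s \<le> dual_value g" by (rule field_le_epsilon)
  moreover have "dual_value \<psi> \<le> s" if "continuous_on Y \<psi>" for \<psi>
    unfolding s_def using that by (intro cSUP_upper dual_value_bdd_above) simp
  ultimately have "optimal_potential c Y \<mu> \<nu> g"
    unfolding optimal_potential_def using g by (auto simp: dual_fun_eq_dual_value intro: order_trans)
  then show ?thesis by blast
qed

end

section \<open>Minimisers of the reduced cost\<close>

lemma compact_argmin_graph:
  fixes f :: "'p::metric_space \<Rightarrow> 'b::metric_space \<Rightarrow> real"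
  assumes P: "compact P" and Y: "compact Y" and f: "continuous_on (P \<times> Y) (\<lambda>w. f (fst w) (snd w))"
  shows "compact {w\<in>P \<times> Y. \<forall>z\<in>Y. f (fst w) (snd w) \<le> f (fst w) z}"
proof -
  have PY: "compact (P \<times> Y)" by (intro compact_Times P Y)
  have "closed {w\<in>P \<times> Y. f (fst w) (snd w) \<le> f (fst w) z}" if "z \<in> Y" for z
  proof (rule continuous_on_closed_Collect_le[OF f _ compact_imp_closed[OF PY]])
    have "continuous_on (P \<times> Y) (\<lambda>w. (\<lambda>w. f (fst w) (snd w)) (fst w, z))"
      by (rule continuous_on_compose2[OF f]) (use that in \<open>auto intro!: continuous_intros\<close>)
    then show "continuous_on (P \<times> Y) (\<lambda>w. f (fst w) z)" by simp
  qed
  then have "compact (P \<times> Y \<inter> (\<Inter>z\<in>Y. {w\<in>P \<times> Y. f (fst w) (snd w) \<le> f (fst w) z}))"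
    by (intro compact_Int_closed PY closed_INT) auto
  moreover have "P \<times> Y \<inter> (\<Inter>z\<in>Y. {w\<in>P \<times> Y. f (fst w) (snd w) \<le> f (fst w) z})
      = {w\<in>P \<times> Y. \<forall>z\<in>Y. f (fst w) (snd w) \<le> f (fst w) z}"
    by blast
  ultimately show ?thesis by simp
qed

text \<open>The pairs of the relation whose second component stays away from \<open>y0\<close> form a compact set, and
  its projection misses \<open>p0\<close>.\<close>

lemma compact_relation_single_valued:
  fixes K :: "('p::metric_space \<times> 'b::metric_space) set"
  assumes K: "compact K" and single: "\<And>y. (p0, y) \<in> K \<Longrightarrow> y = y0" and e: "e > 0"
  obtains d where "d > 0" "\<And>p y. (p, y) \<in> K \<Longrightarrow> dist p p0 < d \<Longrightarrow> dist y y0 < e"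
proof -
  define A where "A = fst ` (K \<inter> UNIV \<times> (- ball y0 e))"
  have "compact A"
    unfolding A_def
    by (intro compact_continuous_image continuous_intros compact_Int_closed K closed_Times) auto
  then have "open (- A)" by (simp add: compact_imp_closed open_Compl)
  moreover have "p0 \<in> - A"
    using single e by (auto simp: A_def)
  ultimately obtain d where d: "d > 0" "ball p0 d \<subseteq> - A"
    by (rule openE)
  have "dist y y0 < e" if K: "(p, y) \<in> K" and p: "dist p p0 < d" for p y
  proof (rule ccontr)
    assume "\<not> dist y y0 < e"
    then have "p \<in> A"
      using K unfolding A_def by (force simp: dist_commute)
    moreover have "p \<in> ball p0 d" using p by (simp add: dist_commute)
    ultimately show False using d(2) by blast
  qed
  then show ?thesis using that d(1) by blast
qed

context continuous_transport
begin

lemma compact_minimizers_graph: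
  assumes \<psi>: "continuous_on Y \<psi>"
  shows "compact {w\<in>X \<times> Y. snd w \<in> minimizers \<psi> (fst w)}"
proof -
  have "continuous_on (X \<times> Y) (\<lambda>w. c (fst w) (snd w) - \<psi> (snd w))"
    using continuous_cost
    by (intro continuous_intros continuous_on_compose2[OF \<psi>]) (auto simp: case_prod_unfold)
  from compact_argmin_graph[OF compact_X compact_Y this]
  show ?thesis by (rule back_subst[of compact]) (auto simp: minimizers_def)
qed

lemma integrable_reduced_cost:
  assumes \<psi>: "continuous_on Y \<psi>" and t: "t \<in> measurable \<mu> \<nu>"
  shows "integrable \<mu> (\<lambda>x. c x (t x) - \<psi> (t x))"
proof -
  obtain C where "\<And>x y. x \<in> X \<Longrightarrow> y \<in> Y \<Longrightarrow> \<bar>c x y\<bar> \<le> C" using cost_bound by blast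
  then have "integrable \<mu> (\<lambda>x. c x (t x))"
    using measurable_\<mu>_\<nu>D(2)[OF t]
    by (intro \<mu>.integrable_const_bound[of _ C] measurable_cost_along t) (auto simp: space_\<mu>)
  then show ?thesis
    by (intro Bochner_Integration.integrable_diff integrable_\<mu>_continuous_comp \<psi> t)
qed

text \<open>The reduced cost along \<open>t\<close> dominates \<open>\<psi>\<^sup>c\<close>, so the integrals agree only if the functions do almost
  everywhere, which means that \<open>t x\<close> is a minimiser.\<close>

lemma F_fun_eq_dual_fun_iff:
  assumes \<psi>: "continuous_on Y \<psi>" and t: "t \<in> measurable \<mu> \<nu>"
  shows "F_fun c \<mu> \<nu> \<psi> t = dual_fun c Y \<mu> \<nu> \<psi> \<longleftrightarrow> (AE x in \<mu>. t x \<in> minimizers \<psi> x)"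
proof -
  let ?r = "\<lambda>x. c x (t x) - \<psi> (t x)"
  have tY: "t x \<in> Y" if "x \<in> X" for x using measurable_\<mu>_\<nu>D(2)[OF t that] .
  obtain K where K: "\<And>x. x \<in> X \<Longrightarrow> K \<le> ctr \<psi> x" using ctr_lower_bound[OF \<psi>] by blast
  have Kr: "K \<le> ?r x" if "x \<in> X" for x
    using K[OF that] ctr_le[OF \<psi> that tY[OF that]] by linarith
  have ri: "ext_integral \<mu> (\<lambda>x. ereal (?r x)) = ereal (\<integral>x. ?r x \<partial>\<mu>)"
    using ext_integral_ereal[OF \<mu>.finite_measure_axioms borel_measurable_integrable[OF integrable_reduced_cost[OF \<psi> t]], of K]
      integrable_reduced_cost[OF \<psi> t] Kr by (simp add: space_\<mu>)
  have "(F_fun c \<mu> \<nu> \<psi> t = dual_fun c Y \<mu> \<nu> \<psi>) \<longleftrightarrow> (\<integral>x. ctr \<psi> x \<partial>\<mu>) = (\<integral>x. ?r x \<partial>\<mu>)"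
    by (auto simp: F_fun_eq[OF \<psi> t] dual_fun_eq_dual_value[OF \<psi>] dual_value_def ri)
  also have "\<dots> \<longleftrightarrow> (\<integral>x. ?r x - ctr \<psi> x \<partial>\<mu>) = 0"
    by (auto simp: integrable_reduced_cost[OF \<psi> t] integrable_ctr[OF \<psi>])
  also have "\<dots> \<longleftrightarrow> (AE x in \<mu>. ?r x - ctr \<psi> x = 0)"
    by (intro integral_nonneg_eq_0_iff_AE Bochner_Integration.integrable_diff integrable_reduced_cost
        integrable_ctr \<psi> t AE_I2) (use ctr_le[OF \<psi> _ tY] in \<open>simp add: space_\<mu>\<close>)
  also have "\<dots> \<longleftrightarrow> (AE x in \<mu>. t x \<in> minimizers \<psi> x)"
    by (intro AE_cong) (use minimizer_iff_ctr[OF \<psi> _ tY] in \<open>simp add: space_\<mu>\<close>)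
  finally show ?thesis .
qed

subsection \<open>First variation of the dual problem\<close>

text \<open>Let \<open>\<psi>\<close> be optimal and \<open>t s\<close> a minimising map for \<open>\<psi> + s \<eta>\<close>. Optimality yields
  \<open>\<integral>\<eta> d\<nu> \<le> \<integral>\<eta>(t s x) d\<mu>\<close> for \<open>s > 0\<close>, and where the minimiser for \<open>\<psi>\<close> is unique, \<open>t s x\<close> tends to it
  as \<open>s\<close> tends to \<open>0\<close>. The reverse inequality is the one for \<open>- \<eta>\<close>.\<close>

lemma minimizing_map_first_variation:
  fixes \<eta> :: "'b \<Rightarrow> real"
  assumes opt: "optimal_potential c Y \<mu> \<nu> \<psi>" and T: "T \<in> measurable \<mu> \<nu>"
    and min: "AE x in \<mu>. minimizers \<psi> x = {T x}" and \<eta>: "continuous_on Y \<eta>"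
  shows "(\<integral>y. \<eta> y \<partial>\<nu>) \<le> (\<integral>x. \<eta> (T x) \<partial>\<mu>)"
proof -
  have \<psi>: "continuous_on Y \<psi>" using opt by (simp add: optimal_potential_def)
  define s where "s = (\<lambda>n. 1 / real (Suc n))"
  have s: "0 < s n" "s n \<le> 1" for n by (simp_all add: s_def)
  define \<psi>s where "\<psi>s = (\<lambda>n y. \<psi> y + s n * \<eta> y)"
  have \<psi>s: "continuous_on Y (\<psi>s n)" for n
    unfolding \<psi>s_def by (intro continuous_intros \<psi> \<eta>)
  have "\<exists>t. t \<in> measurable \<mu> \<nu> \<and> (\<forall>x\<in>X. t x \<in> minimizers (\<psi>s n) x)" for n
    using minimizing_map[OF \<psi>s] by metis
  then obtain t where t: "\<And>n. t n \<in> measurable \<mu> \<nu>" "\<And>n x. x \<in> X \<Longrightarrow> t n x \<in> minimizers (\<psi>s n) x"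
    by metis
  have le: "(\<integral>y. \<eta> y \<partial>\<nu>) \<le> (\<integral>x. \<eta> (t n x) \<partial>\<mu>)" for n
  proof -
    note int = integrable_ctr[OF \<psi>] integrable_ctr[OF \<psi>s] integrable_\<mu>_continuous_comp[OF \<eta> t(1)]
      integrable_\<nu>_continuous[OF \<psi>] integrable_\<nu>_continuous[OF \<eta>]
    have "dual_value (\<psi>s n) \<le> dual_value \<psi>"
      using opt \<psi>s[of n] by (auto simp: optimal_potential_def dual_fun_eq_dual_value)
    then have "(\<integral>x. ctr (\<psi>s n) x \<partial>\<mu>) + s n * (\<integral>y. \<eta> y \<partial>\<nu>) \<le> (\<integral>x. ctr \<psi> x \<partial>\<mu>)"
      using int by (simp add: dual_value_def \<psi>s_def)
    also have "\<dots> \<le> (\<integral>x. ctr (\<psi>s n) x + s n * \<eta> (t n x) \<partial>\<mu>)"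
    proof (intro integral_mono Bochner_Integration.integrable_add integrable_mult_right int)
      fix x assume "x \<in> space \<mu>"
      then have x: "x \<in> X" by (simp add: space_\<mu>)
      show "ctr \<psi> x \<le> ctr (\<psi>s n) x + s n * \<eta> (t n x)"
        unfolding ctr_eq_minimizer[OF t(2)[OF x]]
        using ctr_le[OF \<psi> x minimizer_in_Y[OF t(2)[OF x, of n]]] by (simp add: \<psi>s_def)
    qed
    also have "\<dots> = (\<integral>x. ctr (\<psi>s n) x \<partial>\<mu>) + s n * (\<integral>x. \<eta> (t n x) \<partial>\<mu>)"
      using int by simp
    finally show ?thesis using s(1)[of n] by simp
  qed
  obtain B where B: "\<And>y. y \<in> Y \<Longrightarrow> \<bar>\<eta> y\<bar> \<le> B" using continuous_bounded_on_Y[OF \<eta>] by blast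
  have "(\<lambda>n. \<integral>x. \<eta> (t n x) \<partial>\<mu>) \<longlonglongrightarrow> (\<integral>x. \<eta> (T x) \<partial>\<mu>)"
  proof (rule integral_dominated_convergence[where w = "\<lambda>_. B"])
    show "AE x in \<mu>. (\<lambda>n. \<eta> (t n x)) \<longlonglongrightarrow> \<eta> (T x)"
      using min AE_space
    proof eventually_elim
      case (elim x)
      then have x: "x \<in> X" by (simp add: space_\<mu>)
      define K where "K = {w\<in>{0..1::real} \<times> Y. \<forall>z\<in>Y.
        c x (snd w) - (\<psi> (snd w) + fst w * \<eta> (snd w)) \<le> c x z - (\<psi> z + fst w * \<eta> z)}"
      have "continuous_on Y (\<lambda>y. (\<lambda>(x, y). c x y) (x, y))"
        by (rule continuous_on_compose2[OF continuous_cost]) (use x in \<open>auto intro!: continuous_intros\<close>)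
      then have cx: "continuous_on Y (c x)" by simp
      have K: "compact K"
        unfolding K_def
        by (intro compact_argmin_graph[where f = "\<lambda>r y. c x y - (\<psi> y + r * \<eta> y)"] compact_Icc compact_Y
            continuous_intros continuous_on_compose2[OF cx] continuous_on_compose2[OF \<psi>] continuous_on_compose2[OF \<eta>]) auto
      have single: "y = T x" if "(0, y) \<in> K" for y
        using that elim(1) by (auto simp: K_def minimizers_def)
      have tK: "(s n, t n x) \<in> K" for n
        using t(2)[OF x, of n] s[of n] by (auto simp: K_def minimizers_def \<psi>s_def less_imp_le)
      have "s \<longlonglongrightarrow> 0" unfolding s_def by (rule LIMSEQ_Suc[OF lim_1_over_n])
      have "(\<lambda>n. t n x) \<longlonglongrightarrow> T x"
      proof (rule tendstoI)
        fix e :: real assume "e > 0"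
        then obtain d where d: "d > 0" "\<And>r y. (r, y) \<in> K \<Longrightarrow> dist r 0 < d \<Longrightarrow> dist y (T x) < e"
          using compact_relation_single_valued[OF K single] by metis
        have "eventually (\<lambda>n. dist (s n) 0 < d) sequentially"
          by (rule tendstoD[OF \<open>s \<longlonglongrightarrow> 0\<close> d(1)])
        then show "eventually (\<lambda>n. dist (t n x) (T x) < e) sequentially"
          by eventually_elim (rule d(2)[OF tK])
      qed
      then show ?case
        by (rule continuous_on_tendsto_compose[OF \<eta>])
          (use measurable_\<mu>_\<nu>D(2)[OF t(1) x] measurable_\<mu>_\<nu>D(2)[OF T x] in auto)
    qed
    show "AE x in \<mu>. norm (\<eta> (t n x)) \<le> B" for n
      using B measurable_\<mu>_\<nu>D(2)[OF t(1)] by (auto simp: space_\<mu>)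
  qed (use integrable_\<mu>_continuous_comp[OF \<eta> T] integrable_\<mu>_continuous_comp[OF \<eta> t(1)] in \<open>auto\<close>)
  then show ?thesis by (rule LIMSEQ_le_const) (use le in blast)
qed

lemma minimizing_map_pushforward:
  assumes opt: "optimal_potential c Y \<mu> \<nu> \<psi>" and T: "T \<in> measurable \<mu> \<nu>"
    and min: "AE x in \<mu>. minimizers \<psi> x = {T x}"
  shows "distr \<mu> \<nu> T = \<nu>"
proof (rule continuous_integrals_determine_measure[OF _ \<nu>.finite_measure_axioms _ sets_\<nu> compact_Y])
  show "finite_measure (distr \<mu> \<nu> T)" by (rule \<mu>.finite_measure_distr[OF T])
  show "sets (distr \<mu> \<nu> T) = sets (restrict_space borel Y)" by (simp add: sets_\<nu>)
  fix \<eta> :: "'b \<Rightarrow> real" assume \<eta>: "continuous_on Y \<eta>"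
  have "(\<integral>y. - \<eta> y \<partial>\<nu>) \<le> (\<integral>x. - \<eta> (T x) \<partial>\<mu>)"
    by (intro minimizing_map_first_variation[OF opt T min] continuous_intros \<eta>)
  then show "(\<integral>y. \<eta> y \<partial>(distr \<mu> \<nu> T)) = (\<integral>y. \<eta> y \<partial>\<nu>)"
    using minimizing_map_first_variation[OF opt T min \<eta>]
    by (simp add: integral_distr[OF T continuous_measurable_\<nu>[OF \<eta>]])
qed

section \<open>Saddle points when minimisers are unique\<close>

text \<open>For a transport map the potential drops out of \<open>F\<close>, which is then the transport cost.\<close>

lemma F_fun_transport_map:
  assumes "distr \<mu> \<nu> t = \<nu>"
  shows "F_fun c \<mu> \<nu> \<psi> t = ext_integral \<mu> (\<lambda>x. ereal (c x (t x)))"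
  by (simp add: F_fun_def assms)

lemma saddle_pair_if_minimizing:
  assumes opt: "optimal_potential c Y \<mu> \<nu> \<psi>" and T: "T \<in> measurable \<mu> \<nu>"
    and min: "AE x in \<mu>. minimizers \<psi> x = {T x}"
  shows "saddle_pair c Y \<mu> \<nu> \<psi> T"
proof -
  have \<psi>: "continuous_on Y \<psi>" using opt by (simp add: optimal_potential_def)
  have "AE x in \<mu>. T x \<in> minimizers \<psi> x" using min by eventually_elim simp
  then have "F_fun c \<mu> \<nu> \<psi> T = dual_fun c Y \<mu> \<nu> \<psi>" using F_fun_eq_dual_fun_iff[OF \<psi> T] by simp
  then show ?thesis
    unfolding saddle_pair_def
    using opt T dual_fun_le_F_fun[OF \<psi>] F_fun_transport_map[OF minimizing_map_pushforward[OF opt T min]]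
    by simp
qed

text \<open>Minimality in the second argument makes almost all values of \<open>T\<close> minimisers. The supremum over the first
  argument is the finite value at \<open>\<psi>\<close>, so \<open>T\<close> cannot miss \<open>\<nu>\<close>.\<close>

lemma saddle_pair_minimizing:
  assumes "saddle_pair c Y \<mu> \<nu> \<psi> T"
  shows "continuous_on Y \<psi>" "T \<in> measurable \<mu> \<nu>" "F_fun c \<mu> \<nu> \<psi> T = dual_fun c Y \<mu> \<nu> \<psi>"
    "AE x in \<mu>. T x \<in> minimizers \<psi> x" "distr \<mu> \<nu> T = \<nu>"
proof -
  show \<psi>: "continuous_on Y \<psi>" and T: "T \<in> measurable \<mu> \<nu>"
    using assms by (simp_all add: saddle_pair_def optimal_potential_def)
  obtain t where t: "t \<in> measurable \<mu> \<nu>" "\<And>x. x \<in> X \<Longrightarrow> t x \<in> minimizers \<psi> x"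
    using minimizing_map[OF \<psi>] by blast
  have "F_fun c \<mu> \<nu> \<psi> T \<le> F_fun c \<mu> \<nu> \<psi> t"
    using assms \<psi> t(1) unfolding saddle_pair_def by blast
  then show F: "F_fun c \<mu> \<nu> \<psi> T = dual_fun c Y \<mu> \<nu> \<psi>"
    using F_fun_minimizing_map[OF \<psi> t] dual_fun_le_F_fun[OF \<psi> T] by simp
  then show "AE x in \<mu>. T x \<in> minimizers \<psi> x"
    using F_fun_eq_dual_fun_iff[OF \<psi> T] by simp
  show "distr \<mu> \<nu> T = \<nu>"
  proof (rule ccontr)
    assume "distr \<mu> \<nu> T \<noteq> \<nu>"
    then have "\<infinity> = (SUP \<psi>'\<in>{\<psi>'. continuous_on Y \<psi>'}. F_fun c \<mu> \<nu> \<psi>' T)"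
      by (simp add: SUP_F_fun_eq_infinity[OF T])
    also have "\<dots> \<le> F_fun c \<mu> \<nu> \<psi> T"
      using assms T unfolding saddle_pair_def by (intro SUP_least) auto
    also have "\<dots> = ereal (dual_value \<psi>)" by (simp add: F dual_fun_eq_dual_value[OF \<psi>])
    finally show False by simp
  qed
qed

lemma saddle_pair_optimal_transport_map:
  assumes "saddle_pair c Y \<mu> \<nu> \<psi> T"
  shows "optimal_transport_map c \<mu> \<nu> T"
  unfolding optimal_transport_map_def
proof (intro conjI ballI impI)
  note sp = saddle_pair_minimizing[OF assms]
  show "T \<in> measurable \<mu> \<nu>" "distr \<mu> \<nu> T = \<nu>" by (fact sp)+
  fix t assume t: "t \<in> measurable \<mu> \<nu>" "distr \<mu> \<nu> t = \<nu>"
  show "ext_integral \<mu> (\<lambda>x. ereal (c x (T x))) \<le> ext_integral \<mu> (\<lambda>x. ereal (c x (t x)))"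
    using dual_fun_le_F_fun[OF sp(1) t(1)] sp(3)
    by (simp add: F_fun_transport_map[OF sp(5)] F_fun_transport_map[OF t(2)])
qed

text \<open>An optimal map has the same transport cost as \<open>T\<close>, hence the same value of \<open>F \<psi>\<close>, which is minimal.\<close>

lemma optimal_transport_map_minimizing:
  assumes sp: "saddle_pair c Y \<mu> \<nu> \<psi> T" and t: "optimal_transport_map c \<mu> \<nu> t"
  shows "AE x in \<mu>. t x \<in> minimizers \<psi> x"
proof -
  note sp' = saddle_pair_minimizing[OF sp]
  have t': "t \<in> measurable \<mu> \<nu>" "distr \<mu> \<nu> t = \<nu>"
    using t by (simp_all add: optimal_transport_map_def)
  have "F_fun c \<mu> \<nu> \<psi> t \<le> F_fun c \<mu> \<nu> \<psi> T"
    using t sp'(2,5) unfolding optimal_transport_map_def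
    by (simp add: F_fun_transport_map)
  then have "F_fun c \<mu> \<nu> \<psi> t = dual_fun c Y \<mu> \<nu> \<psi>"
    using dual_fun_le_F_fun[OF sp'(1) t'(1)] sp'(3) by simp
  then show ?thesis using F_fun_eq_dual_fun_iff[OF sp'(1) t'(1)] by simp
qed

end

section \<open>Smooth strictly convex costs of the displacement\<close>

text \<open>\<open>G\<close> is a continuous and injective subgradient of the convex function \<open>h\<close>, which makes \<open>h\<close>
  continuously differentiable with gradient \<open>G\<close>, and strictly convex.\<close>

locale convex_transport = transport X Y \<mu> \<nu> c
  for X Y :: "'a::euclidean_space set" and \<mu> \<nu> c +
  fixes h :: "'a \<Rightarrow> real" and G :: "'a \<Rightarrow> 'a"
  assumes cost: "\<And>x y. x \<in> X \<Longrightarrow> y \<in> Y \<Longrightarrow> c x y = h (x - y)"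
    and subgradient: "\<And>v w. G v \<bullet> (w - v) \<le> h w - h v"
    and continuous_G: "continuous_on UNIV G" and inj_G: "inj G"
    and ac: "absolutely_continuous (restrict_space lborel X) \<mu>"

lemma continuous_if_continuous_subgradient:
  fixes h :: "'a::euclidean_space \<Rightarrow> real"
  assumes subgradient: "\<And>v w. G v \<bullet> (w - v) \<le> h w - h v" and G: "continuous_on UNIV G"
  shows "continuous_on UNIV h"
  unfolding continuous_on_def
proof
  fix v
  have G': "(G \<longlongrightarrow> G v) (at v)" using G by (simp add: continuous_on_def)
  have "((\<lambda>w. h v + G v \<bullet> (w - v)) \<longlongrightarrow> h v + G v \<bullet> (v - v)) (at v)"
    and "((\<lambda>w. h v - G w \<bullet> (v - w)) \<longlongrightarrow> h v - G v \<bullet> (v - v)) (at v)"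
    by (intro tendsto_intros G')+
  moreover have "h v + G v \<bullet> (w - v) \<le> h w" "h w \<le> h v - G w \<bullet> (v - w)" for w
    using subgradient[of v w] subgradient[of w v] by simp_all
  ultimately show "(h \<longlongrightarrow> h v) (at v within UNIV)"
    by (intro tendsto_sandwich[of "\<lambda>w. h v + G v \<bullet> (w - v)" h _ "\<lambda>w. h v - G w \<bullet> (v - w)"]) simp_all
qed

sublocale convex_transport \<subseteq> continuous_transport
proof
  have "continuous_on (X \<times> Y) (\<lambda>w. h (fst w - snd w))"
    by (intro continuous_on_compose2[OF continuous_if_continuous_subgradient[OF subgradient continuous_G]]
        continuous_intros) simp
  then show "continuous_on (X \<times> Y) (\<lambda>(x, y). c x y)"
    by (rule continuous_on_eq) (auto simp: cost)
qed

context convex_transport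
begin

lemma null_set_if_thin:
  assumes "compact S" "S \<subseteq> X" "\<And>x s. x \<in> S \<Longrightarrow> s > 0 \<Longrightarrow> x + s *\<^sub>R e \<notin> S"
  shows "S \<in> null_sets \<mu>"
proof -
  have "X \<in> sets lborel" using borel_compact[OF compact_X] by simp
  then have "S \<in> null_sets (restrict_space lborel X)"
    using null_set_if_directionally_thin[OF assms(1,3)] assms(2) by (simp add: null_sets_restrict_space)
  then show ?thesis using ac unfolding absolutely_continuous_def by blast
qed

text \<open>Between \<open>x\<close> and \<open>x + s e\<close> the transform grows at least with slope
  \<open>G (x - y) \<bullet> e\<close>, for \<open>y\<close> a minimiser at the upper end, and at most with slope \<open>G (x + s e - z) \<bullet> e\<close>,
  for \<open>z\<close> a minimiser at the lower end.\<close>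

lemma minimizers_slope:
  assumes \<psi>: "continuous_on Y \<psi>" and x: "x \<in> X" "x + s *\<^sub>R e \<in> X" and s: "s > 0"
    and y: "y \<in> minimizers \<psi> (x + s *\<^sub>R e)" and z: "z \<in> minimizers \<psi> x"
  shows "G (x - y) \<bullet> e \<le> G (x + s *\<^sub>R e - z) \<bullet> e"
proof -
  let ?x = "x + s *\<^sub>R e"
  have Y: "y \<in> Y" "z \<in> Y" using y z minimizer_in_Y by auto
  have "s * (G (x - y) \<bullet> e) \<le> h (?x - y) - h (x - y)"
    using subgradient[of "x - y" "?x - y"] by simp
  also have "\<dots> \<le> ctr \<psi> ?x - ctr \<psi> x"
    using ctr_le[OF \<psi> x(1) Y(1)] ctr_eq_minimizer[OF y] by (simp add: cost x Y)
  also have "\<dots> \<le> h (?x - z) - h (x - z)"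
    using ctr_le[OF \<psi> x(2) Y(2)] ctr_eq_minimizer[OF z] by (simp add: cost x Y)
  also have "\<dots> \<le> s * (G (?x - z) \<bullet> e)"
    using subgradient[of "?x - z" "x - z"] by simp
  finally show ?thesis using s by simp
qed

text \<open>If \<open>x\<close> and \<open>x + s e\<close> both belonged to the set, the slope inequality for a minimiser in \<open>V\<close> at the
  upper end and one in \<open>W\<close> at the lower end would contradict the separation of slopes.\<close>

lemma two_minimizers_null:
  assumes \<psi>: "continuous_on Y \<psi>" and cl: "closed U" "closed V" "closed W"
    and sep: "\<And>u u' y z. \<lbrakk>u \<in> U; u' \<in> U; y \<in> V; z \<in> W\<rbrakk> \<Longrightarrow> G (u' - z) \<bullet> e < G (u - y) \<bullet> e"
  shows "{x\<in>X \<inter> U. minimizers \<psi> x \<inter> V \<noteq> {} \<and> minimizers \<psi> x \<inter> W \<noteq> {}} \<in> null_sets \<mu>"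
proof (rule null_set_if_thin)
  let ?S = "{x\<in>X \<inter> U. minimizers \<psi> x \<inter> V \<noteq> {} \<and> minimizers \<psi> x \<inter> W \<noteq> {}}"
  let ?K = "{w\<in>X \<times> Y. snd w \<in> minimizers \<psi> (fst w)}"
  have cpt: "compact (fst ` (?K \<inter> U \<times> C))" if "closed C" for C
    by (intro compact_continuous_image continuous_intros compact_Int_closed compact_minimizers_graph \<psi>
        closed_Times cl that)
  have proj: "fst ` (?K \<inter> U \<times> C) = {x\<in>X \<inter> U. minimizers \<psi> x \<inter> C \<noteq> {}}" for C
  proof (intro equalityI subsetI)
    fix x assume "x \<in> {x\<in>X \<inter> U. minimizers \<psi> x \<inter> C \<noteq> {}}"
    then obtain y where "x \<in> X" "x \<in> U" "y \<in> minimizers \<psi> x" "y \<in> C" by blast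
    then have "(x, y) \<in> ?K \<inter> U \<times> C" using minimizer_in_Y by simp
    then show "x \<in> fst ` (?K \<inter> U \<times> C)" by (rule image_eqI[rotated]) simp
  qed auto
  have "?S = fst ` (?K \<inter> U \<times> V) \<inter> fst ` (?K \<inter> U \<times> W)"
    unfolding proj by blast
  then show "compact ?S"
    using cpt[OF cl(2)] cpt[OF cl(3)] by (simp add: compact_Int)
  show "?S \<subseteq> X" by blast
  fix x and s :: real assume x: "x \<in> ?S" and s: "s > 0"
  show "x + s *\<^sub>R e \<notin> ?S"
  proof
    assume x': "x + s *\<^sub>R e \<in> ?S"
    obtain y z where "y \<in> minimizers \<psi> (x + s *\<^sub>R e)" "y \<in> V" "z \<in> minimizers \<psi> x" "z \<in> W"
      using x x' by blast
    then show False
      using minimizers_slope[OF \<psi> _ _ s, of x e y z] sep[of x "x + s *\<^sub>R e" y z] x x' by auto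
  qed
qed

text \<open>Two distinct minimisers at \<open>x\<close> have different slopes. These stay separated in one direction for
  points near \<open>x\<close> and near the two minimisers, so countably many sets as above
  cover all points with several minimisers.\<close>

theorem AE_minimizer_unique:
  assumes \<psi>: "continuous_on Y \<psi>"
  shows "AE x in \<mu>. \<forall>y\<in>minimizers \<psi> x. \<forall>z\<in>minimizers \<psi> x. y = z"
proof -
  obtain D :: "'a set" where D: "countable D" "\<And>S. open S \<Longrightarrow> S \<noteq> {} \<Longrightarrow> \<exists>d\<in>D. d \<in> S"
    using countable_dense_exists by metis
  define r where "r = (\<lambda>n. 1 / real (Suc n))"
  define good where "good = (\<lambda>(u0, y0, z0, n). \<exists>e. \<forall>u\<in>cball u0 (r n). \<forall>u'\<in>cball u0 (r n).
    \<forall>y\<in>cball y0 (r n). \<forall>z\<in>cball z0 (r n). G (u' - z) \<bullet> e < G (u - y) \<bullet> e)"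
  define N where "N = (\<lambda>(u0, y0, z0, n). {x\<in>X \<inter> cball u0 (r n). minimizers \<psi> x \<inter> cball y0 (r n) \<noteq> {}
    \<and> minimizers \<psi> x \<inter> cball z0 (r n) \<noteq> {}})"
  define I where "I = {i \<in> D \<times> D \<times> D \<times> UNIV. good i}"
  have "N i \<in> null_sets \<mu>" if "i \<in> I" for i
  proof -
    obtain u0 y0 z0 n where i: "i = (u0, y0, z0, n)" by (cases i) auto
    have "good (u0, y0, z0, n)" using that by (simp add: I_def i)
    then obtain e where "\<forall>u\<in>cball u0 (r n). \<forall>u'\<in>cball u0 (r n). \<forall>y\<in>cball y0 (r n).
        \<forall>z\<in>cball z0 (r n). G (u' - z) \<bullet> e < G (u - y) \<bullet> e"
      unfolding good_def prod.case by blast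
    then show ?thesis
      unfolding N_def i prod.case by (intro two_minimizers_null[OF \<psi>, where e = e] closed_cball) blast
  qed
  moreover have "countable I"
    unfolding I_def by (rule countable_subset[of _ "D \<times> D \<times> D \<times> UNIV"]) (auto intro!: countable_SIGMA D(1))
  ultimately have "(\<Union>i\<in>I. N i) \<in> null_sets \<mu>" by (intro null_sets_UN')
  then have "AE x in \<mu>. x \<notin> (\<Union>i\<in>I. N i)" by (rule AE_not_in)
  then show ?thesis
    using AE_space
  proof eventually_elim
    case (elim x)
    then have x: "x \<in> X" by (simp add: space_\<mu>)
    show ?case
    proof (intro ballI, rule ccontr)
      fix y z assume y: "y \<in> minimizers \<psi> x" and z: "z \<in> minimizers \<psi> x" and "y \<noteq> z"
      define e where "e = G (x - y) - G (x - z)"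
      have "G (x - y) \<noteq> G (x - z)"
        using injD[OF inj_G, of "x - y" "x - z"] \<open>y \<noteq> z\<close> by auto
      then have e: "norm e > 0" by (simp add: e_def)
      have slope_near: "\<exists>d>0. \<forall>w. dist w v < d \<longrightarrow> dist (G w) (G v) < norm e / 2" for v
        using continuous_G half_gt_zero[OF e] unfolding continuous_on_iff by blast
      obtain dy where dy: "dy > 0" "\<forall>w. dist w (x - y) < dy \<longrightarrow> dist (G w) (G (x - y)) < norm e / 2"
        using slope_near by blast
      obtain dz where dz: "dz > 0" "\<forall>w. dist w (x - z) < dz \<longrightarrow> dist (G w) (G (x - z)) < norm e / 2"
        using slope_near by blast
      have cs: "\<bar>v \<bullet> e\<bar> < norm e / 2 * norm e" if "norm v < norm e / 2" for v
        by (rule le_less_trans[OF Cauchy_Schwarz_ineq2 mult_strict_right_mono[OF that e]])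
      obtain n where n: "4 * r n < min dy dz"
      proof -
        have "0 < min dy dz / 4" using dy(1) dz(1) by simp
        then obtain n where "inverse (real (Suc n)) < min dy dz / 4" using reals_Archimedean by blast
        then show ?thesis by (intro that[of n]) (simp add: r_def inverse_eq_divide)
      qed
      have r: "r n > 0" by (simp add: r_def)
      have near: "\<exists>d\<in>D. w \<in> cball d (r n)" for w
        using D(2)[of "ball w (r n)"] r by (auto simp: dist_commute intro: less_imp_le)
      obtain u0 y0 z0 where c: "u0 \<in> D" "x \<in> cball u0 (r n)" "y0 \<in> D" "y \<in> cball y0 (r n)"
        "z0 \<in> D" "z \<in> cball z0 (r n)"
        using near[of x] near[of y] near[of z] by blast
      have two: "dist w w' \<le> 2 * r n" if "w \<in> cball d (r n)" "w' \<in> cball d (r n)" for w w' d :: 'a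
        using that dist_triangle3[of w w' d] by simp
      have diff: "dist (u - w) (x - w') \<le> 4 * r n"
        if "u \<in> cball u0 (r n)" "w \<in> cball d (r n)" "w' \<in> cball d (r n)" for u w w' d
      proof -
        have "dist (u - w) (x - w') \<le> dist u x + dist w w'"
          using norm_triangle_ineq4[of "u - x" "w - w'"] by (simp add: dist_norm algebra_simps)
        then show ?thesis using two[OF that(1) c(2)] two[OF that(2,3)] by linarith
      qed
      have "good (u0, y0, z0, n)"
        unfolding good_def prod.case
      proof (intro exI[of _ e] ballI)
        fix u u' y' z' assume u: "u \<in> cball u0 (r n)" and u': "u' \<in> cball u0 (r n)"
          and y': "y' \<in> cball y0 (r n)" and z': "z' \<in> cball z0 (r n)"
        have 1: "\<bar>(G (u - y') - G (x - y)) \<bullet> e\<bar> < norm e / 2 * norm e"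
          using dy(2) diff[OF u y' c(4)] n by (intro cs) (simp add: dist_norm)
        have 2: "\<bar>(G (u' - z') - G (x - z)) \<bullet> e\<bar> < norm e / 2 * norm e"
          using dz(2) diff[OF u' z' c(6)] n by (intro cs) (simp add: dist_norm)
        have "e \<bullet> e = norm e / 2 * norm e + norm e / 2 * norm e"
          by (simp add: dot_square_norm power2_eq_square)
        moreover have "e \<bullet> e = G (x - y) \<bullet> e - G (x - z) \<bullet> e"
          using inner_diff_left[of "G (x - y)" "G (x - z)" e] by (simp only: e_def[symmetric])
        ultimately show "G (u' - z') \<bullet> e < G (u - y') \<bullet> e"
          using 1 2 unfolding inner_diff_left abs_less_iff by linarith
      qed
      then have "(u0, y0, z0, n) \<in> I" using c by (simp add: I_def)
      moreover have "x \<in> N (u0, y0, z0, n)" using x y z c by (auto simp: N_def)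
      ultimately show False using elim(1) by blast
    qed
  qed
qed

end

context convex_transport
begin

section \<open>Derivatives within the domain\<close>

text \<open>If the zero function has a nonzero derivative \<open>w\<close> within \<open>X\<close> at \<open>x\<close>, then near \<open>x\<close> the set \<open>X\<close> avoids a
  double cone with apex \<open>x\<close> and an axis \<open>d\<close> close to \<open>w\<close>. The points of a small ball that have this property for
  a fixed axis and a fixed radius \<open>r\<close> include no two points on a line parallel to \<open>d\<close>: each would lie in the
  cone of the other. The ball of radius \<open>r / 3\<close> keeps them within distance \<open>r\<close> of each other.\<close>

lemma cone_free_null:
  assumes d: "d \<noteq> 0" and r: "0 < r"
  shows "{x\<in>X \<inter> cball u (r / 3). \<forall>z\<in>X. dist z x < r \<longrightarrow> \<bar>d \<bullet> (z - x)\<bar> \<le> 2 / 3 * norm d * norm (z - x)}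
    \<in> null_sets \<mu>" (is "?S \<in> _")
proof (rule null_set_if_thin[where e = d])
  have "closed ({x. r \<le> dist z x} \<union> {x. \<bar>d \<bullet> (z - x)\<bar> \<le> 2 / 3 * norm d * norm (z - x)})" for z
    by (intro closed_Un closed_Collect_le continuous_intros)
  then have "compact (X \<inter> (cball u (r / 3) \<inter>
      (\<Inter>z\<in>X. {x. r \<le> dist z x} \<union> {x. \<bar>d \<bullet> (z - x)\<bar> \<le> 2 / 3 * norm d * norm (z - x)})))"
    by (intro compact_Int_closed compact_X closed_Int closed_cball closed_INT) auto
  moreover have "X \<inter> (cball u (r / 3) \<inter>
      (\<Inter>z\<in>X. {x. r \<le> dist z x} \<union> {x. \<bar>d \<bullet> (z - x)\<bar> \<le> 2 / 3 * norm d * norm (z - x)})) = ?S"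
    unfolding not_less[symmetric] by blast
  ultimately show "compact ?S" by simp
  show "?S \<subseteq> X" by blast
  fix x and s :: real assume x: "x \<in> ?S" and s: "s > 0"
  show "x + s *\<^sub>R d \<notin> ?S"
  proof
    assume x': "x + s *\<^sub>R d \<in> ?S"
    have "dist (x + s *\<^sub>R d) x < r"
      using x x' r dist_triangle3[of "x + s *\<^sub>R d" x u] by simp
    then have "\<bar>d \<bullet> (s *\<^sub>R d)\<bar> \<le> 2 / 3 * norm d * norm (s *\<^sub>R d)"
      using x x' by fastforce
    then show False
      using s d by (simp add: dot_square_norm power2_eq_square abs_mult)
  qed
qed

theorem AE_derivative_within_unique:
  "AE x in \<mu>. \<forall>w. ((\<lambda>_. 0 :: real) has_derivative (\<lambda>v. w \<bullet> v)) (at x within X) \<longrightarrow> w = 0"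
proof -
  obtain D :: "'a set" where D: "countable D" "\<And>S. open S \<Longrightarrow> S \<noteq> {} \<Longrightarrow> \<exists>d\<in>D. d \<in> S"
    using countable_dense_exists by metis
  define r where "r = (\<lambda>n. 1 / real (Suc n))"
  define N where "N = (\<lambda>(d, u, n). {x\<in>X \<inter> cball u (r n / 3).
    \<forall>z\<in>X. dist z x < r n \<longrightarrow> \<bar>d \<bullet> (z - x)\<bar> \<le> 2 / 3 * norm d * norm (z - x)})"
  define I where "I = (D - {0}) \<times> D \<times> (UNIV :: nat set)"
  have r: "r n > 0" for n by (simp add: r_def)
  have "N i \<in> null_sets \<mu>" if "i \<in> I" for i
    using that cone_free_null[OF _ r] by (auto simp: I_def N_def)
  moreover have "countable I"
    unfolding I_def by (intro countable_SIGMA countable_Diff D(1)) auto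
  ultimately have "(\<Union>i\<in>I. N i) \<in> null_sets \<mu>" by (intro null_sets_UN')
  then have "AE x in \<mu>. x \<notin> (\<Union>i\<in>I. N i)" by (rule AE_not_in)
  then show ?thesis
    using AE_space
  proof eventually_elim
    case (elim x)
    then have x: "x \<in> X" by (simp add: space_\<mu>)
    show ?case
    proof (intro allI impI, rule ccontr)
      fix w assume w: "((\<lambda>_. 0 :: real) has_derivative (\<lambda>v. w \<bullet> v)) (at x within X)" and "w \<noteq> 0"
      then have e: "norm w / 4 > 0" by simp
      have "\<exists>\<delta>>0. \<forall>z\<in>X. norm (z - x) < \<delta> \<longrightarrow> norm (0 - 0 - w \<bullet> (z - x)) \<le> norm w / 4 * norm (z - x)"
        using w e unfolding has_derivative_within_alt by blast
      then obtain \<delta> where \<delta>: "\<delta> > 0"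
        "\<forall>z\<in>X. norm (z - x) < \<delta> \<longrightarrow> norm (0 - 0 - w \<bullet> (z - x)) \<le> norm w / 4 * norm (z - x)" by blast
      obtain n where n: "r n < \<delta>"
        using reals_Archimedean[OF \<delta>(1)] by (auto simp: r_def inverse_eq_divide)
      obtain d where d: "d \<in> D" "dist w d < norm w / 4"
        using D(2)[of "ball w (norm w / 4)"] e by auto
      have nd: "3 / 4 * norm w \<le> norm d"
        using d(2) norm_triangle_ineq2[of w d] by (simp add: dist_norm)
      then have "d \<noteq> 0" using e by auto
      obtain u where u: "u \<in> D" "x \<in> cball u (r n / 3)"
        using D(2)[of "ball x (r n / 3)"] r[of n] by (auto simp: dist_commute intro: less_imp_le)
      have "\<bar>d \<bullet> (z - x)\<bar> \<le> 2 / 3 * norm d * norm (z - x)" if z: "z \<in> X" "dist z x < r n" for z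
      proof -
        have "\<bar>(d - w) \<bullet> (z - x)\<bar> \<le> norm w / 4 * norm (z - x)"
          using d(2) by (intro order_trans[OF Cauchy_Schwarz_ineq2] mult_right_mono) (simp_all add: dist_norm norm_minus_commute)
        moreover have "\<bar>w \<bullet> (z - x)\<bar> \<le> norm w / 4 * norm (z - x)"
          using \<delta>(2) z n by (simp add: dist_norm)
        ultimately have "\<bar>d \<bullet> (z - x)\<bar> \<le> norm w / 2 * norm (z - x)"
          unfolding inner_diff_left by linarith
        also have "\<dots> \<le> 2 / 3 * norm d * norm (z - x)"
          using nd by (intro mult_right_mono) simp_all
        finally show ?thesis .
      qed
      then have "x \<in> N (d, u, n)" using x u by (simp add: N_def)
      moreover have "(d, u, n) \<in> I" using d(1) \<open>d \<noteq> 0\<close> u(1) by (simp add: I_def)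
      ultimately show False using elim(1) by blast
    qed
  qed
qed

text \<open>The increment of the transform from \<open>x\<close> to \<open>z\<close> lies between the increments of the cost with the second
  argument fixed, at a minimiser for \<open>z\<close> and at the one for \<open>x\<close>. Minimisers for \<open>z\<close> close to \<open>x\<close> are close to \<open>y\<close>,
  so both increments have slopes close to \<open>G (x - y)\<close>.\<close>

theorem ctr_has_derivative:
  assumes \<psi>: "continuous_on Y \<psi>" and x: "x \<in> X" and min: "minimizers \<psi> x = {y}"
  shows "(ctr \<psi> has_derivative (\<lambda>v. G (x - y) \<bullet> v)) (at x within X)"
  unfolding has_derivative_within_alt
proof (intro conjI allI impI)
  show "bounded_linear (\<lambda>v. G (x - y) \<bullet> v)" by (rule bounded_linear_inner_right)
  fix e :: real assume e: "e > 0"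
  obtain \<delta> where \<delta>: "\<delta> > 0" "\<And>w. dist w (x - y) < \<delta> \<Longrightarrow> dist (G w) (G (x - y)) < e"
    using continuous_G e unfolding continuous_on_iff by (metis UNIV_I)
  have K: "compact {w\<in>X \<times> Y. snd w \<in> minimizers \<psi> (fst w)}" by (rule compact_minimizers_graph[OF \<psi>])
  have "z = y" if "(x, z) \<in> {w\<in>X \<times> Y. snd w \<in> minimizers \<psi> (fst w)}" for z using that min by simp
  from compact_relation_single_valued[OF K this \<delta>(1)] obtain d where d: "d > 0"
    "\<And>x' z. (x', z) \<in> {w\<in>X \<times> Y. snd w \<in> minimizers \<psi> (fst w)} \<Longrightarrow> dist x' x < d \<Longrightarrow> dist z y < \<delta>"
    by blast
  have "norm (ctr \<psi> z - ctr \<psi> x - G (x - y) \<bullet> (z - x)) \<le> e * norm (z - x)"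
    if z: "z \<in> X" "norm (z - x) < min d \<delta>" for z
  proof -
    obtain y' where y': "y' \<in> minimizers \<psi> z" using minimizers_nonempty[OF \<psi> z(1)] by blast
    have y: "y \<in> minimizers \<psi> x" using min by simp
    note Y = minimizer_in_Y[OF y] minimizer_in_Y[OF y']
    have cs: "\<bar>(G w - G (x - y)) \<bullet> (z - x)\<bar> \<le> e * norm (z - x)" if "dist w (x - y) < \<delta>" for w
      using \<delta>(2)[OF that] by (intro order_trans[OF Cauchy_Schwarz_ineq2] mult_right_mono) (simp_all add: dist_norm)
    have "ctr \<psi> z - ctr \<psi> x \<le> h (z - y) - h (x - y)"
      using ctr_le[OF \<psi> z(1) Y(1)] ctr_eq_minimizer[OF y] by (simp add: cost x z(1) Y)
    also have "\<dots> \<le> G (z - y) \<bullet> (z - x)"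
      using subgradient[of "z - y" "x - y"] by (simp add: inner_diff_right)
    finally have "ctr \<psi> z - ctr \<psi> x - G (x - y) \<bullet> (z - x) \<le> (G (z - y) - G (x - y)) \<bullet> (z - x)"
      by (simp add: inner_diff_left)
    moreover have "dist (z - y) (x - y) < \<delta>" using z(2) by (simp add: dist_norm)
    moreover have "G (x - y') \<bullet> (z - x) \<le> h (z - y') - h (x - y')"
      using subgradient[of "x - y'" "z - y'"] by simp
    moreover have "h (z - y') - h (x - y') \<le> ctr \<psi> z - ctr \<psi> x"
      using ctr_le[OF \<psi> x Y(2)] ctr_eq_minimizer[OF y'] by (simp add: cost x z(1) Y)
    moreover have "dist (x - y') (x - y) < \<delta>"
      using d(2)[of z y'] y' Y z by (simp add: dist_norm norm_minus_commute)
    ultimately show ?thesis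
      using cs[of "z - y"] cs[of "x - y'"] by (simp add: inner_diff_left abs_le_iff)
  qed
  then show "\<exists>d>0. \<forall>z\<in>X. norm (z - x) < d \<longrightarrow>
      norm (ctr \<psi> z - ctr \<psi> x - G (x - y) \<bullet> (z - x)) \<le> e * norm (z - x)"
    using d(1) \<delta>(1) by (intro exI[of _ "min d \<delta>"]) auto
qed

section \<open>The saddle point for a strictly convex cost\<close>

lemma AE_minimizers_eq:
  assumes \<psi>: "continuous_on Y \<psi>" and T: "AE x in \<mu>. T x \<in> minimizers \<psi> x"
  shows "AE x in \<mu>. minimizers \<psi> x = {T x}"
  using AE_minimizer_unique[OF \<psi>] T by eventually_elim blast

theorem saddle_pair_exists: "\<exists>\<psi> T. saddle_pair c Y \<mu> \<nu> \<psi> T"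
proof -
  obtain \<psi> where opt: "optimal_potential c Y \<mu> \<nu> \<psi>" using optimal_potential_exists by blast
  then have \<psi>: "continuous_on Y \<psi>" by (simp add: optimal_potential_def)
  obtain T where T: "T \<in> measurable \<mu> \<nu>" "\<And>x. x \<in> X \<Longrightarrow> T x \<in> minimizers \<psi> x"
    using minimizing_map[OF \<psi>] by blast
  then have "AE x in \<mu>. minimizers \<psi> x = {T x}"
    by (intro AE_minimizers_eq[OF \<psi>] AE_I2) (simp add: space_\<mu>)
  then show ?thesis using saddle_pair_if_minimizing[OF opt T(1)] by blast
qed

context
  fixes \<psi> T assumes sp: "saddle_pair c Y \<mu> \<nu> \<psi> T"
begin

lemmas saddle = saddle_pair_minimizing[OF sp]

lemma saddle_minimizers: "AE x in \<mu>. minimizers \<psi> x = {T x}"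
  by (rule AE_minimizers_eq[OF saddle(1,4)])

lemma saddle_arg_min:
  "AE x in \<mu>. {y. is_arg_min (\<lambda>y. c x y - \<psi> y) (\<lambda>y. y \<in> Y) y} = {T x}"
  using saddle_minimizers
proof eventually_elim
  case (elim x)
  have "{y. is_arg_min (\<lambda>y. c x y - \<psi> y) (\<lambda>y. y \<in> Y) y} = minimizers \<psi> x"
    unfolding minimizers_def is_arg_min_linorder by blast
  then show ?case using elim by simp
qed

lemma AE_eq_saddle_map:
  assumes "AE x in \<mu>. t x \<in> minimizers \<psi> x"
  shows "AE x in \<mu>. t x = T x"
  using saddle_minimizers assms by eventually_elim simp

lemma optimal_transport_map_unique:
  "optimal_transport_map c \<mu> \<nu> t \<Longrightarrow> AE x in \<mu>. t x = T x"
  by (intro AE_eq_saddle_map optimal_transport_map_minimizing[OF sp])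

lemma F_fun_minimizer_iff:
  assumes t: "t \<in> measurable \<mu> \<nu>"
  shows "(\<forall>s\<in>measurable \<mu> \<nu>. F_fun c \<mu> \<nu> \<psi> t \<le> F_fun c \<mu> \<nu> \<psi> s) \<longleftrightarrow> (AE x in \<mu>. t x = T x)"
proof -
  have "(\<forall>s\<in>measurable \<mu> \<nu>. F_fun c \<mu> \<nu> \<psi> t \<le> F_fun c \<mu> \<nu> \<psi> s) \<longleftrightarrow> F_fun c \<mu> \<nu> \<psi> t = dual_fun c Y \<mu> \<nu> \<psi>"
    using dual_fun_le_F_fun[OF saddle(1)] saddle(2,3) t by (metis antisym)
  also have "\<dots> \<longleftrightarrow> (AE x in \<mu>. t x \<in> minimizers \<psi> x)"
    by (rule F_fun_eq_dual_fun_iff[OF saddle(1) t])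
  also have "\<dots> \<longleftrightarrow> (AE x in \<mu>. t x = T x)"
  proof
    assume "AE x in \<mu>. t x = T x"
    then show "AE x in \<mu>. t x \<in> minimizers \<psi> x"
      using saddle(4) by eventually_elim simp
  qed (rule AE_eq_saddle_map)
  finally show ?thesis .
qed

lemma saddle_gradient:
  "AE x in \<mu>. has_gradient_within (\<lambda>x. real_of_ereal (ctrans_Y c Y (\<lambda>y. ereal (\<psi> y)) x)) (G (x - T x)) X x"
  using saddle_minimizers AE_derivative_within_unique AE_space
proof eventually_elim
  case (elim x)
  then have x: "x \<in> X" by (simp add: space_\<mu>)
  let ?f = "\<lambda>x. real_of_ereal (ctrans_Y c Y (\<lambda>y. ereal (\<psi> y)) x)"
  have f: "(?f has_derivative (\<lambda>v. G (x - T x) \<bullet> v)) (at x within X)"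
    by (rule has_derivative_transform[OF x _ ctr_has_derivative[OF saddle(1) x elim(1)]])
      (simp add: ctrans_Y_eq_ctr[OF saddle(1)])
  have "g = G (x - T x)" if g: "(?f has_derivative (\<lambda>v. g \<bullet> v)) (at x within X)" for g
  proof -
    have "((\<lambda>_. 0 :: real) has_derivative (\<lambda>v. (g - G (x - T x)) \<bullet> v)) (at x within X)"
      using has_derivative_diff[OF g f] by (simp add: inner_diff_left)
    then have "g - G (x - T x) = 0" using elim(2) by blast
    then show ?thesis by simp
  qed
  then show ?case unfolding has_gradient_within_def using f by blast
qed

end

end

section \<open>The power cost\<close>

text \<open>The gradients of \<open>|v|\<^sup>p / p\<close> and \<open>|g|\<^sup>q / q\<close> are inverse to each other for conjugate exponents.\<close>

lemma power_gradient_inverse: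
  fixes v :: "'a::real_inner"
  assumes p: "1 < p" and q: "1 / q = 1 - 1 / p"
  defines "g \<equiv> norm v powr (p - 2) *\<^sub>R v"
  shows "norm g powr (q - 2) *\<^sub>R g = v"
proof (cases "v = 0")
  case False
  then have v: "norm v > 0" by simp
  have "norm g = norm v powr (p - 2) * norm v powr 1" using v by (simp add: g_def)
  also have "\<dots> = norm v powr (p - 1)" by (subst powr_add[symmetric]) simp
  finally have "norm g powr (q - 2) *\<^sub>R g = norm v powr ((p - 1) * (q - 2) + (p - 2)) *\<^sub>R v"
    by (simp add: g_def powr_powr powr_add)
  moreover have "(p - 1) * (q - 2) + (p - 2) = 0"
  proof -
    have "q \<noteq> 0" using p q by auto
    then have "p = q * (p - 1)" using p q by (simp add: field_simps)
    then show ?thesis by (simp add: algebra_simps)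
  qed
  ultimately show ?thesis using v by simp
qed (simp add: g_def)

text \<open>The subgradient inequality of \<open>|v|\<^sup>p / p\<close> at \<open>v\<close> is Young's inequality for
  \<open>|v|\<close> to the power \<open>p - 1\<close> and \<open>|w|\<close>.\<close>

lemma power_subgradient:
  fixes v w :: "'a::real_inner"
  assumes p: "1 < p" and q: "1 / q = 1 - 1 / p"
  shows "(norm v powr (p - 2) *\<^sub>R v) \<bullet> (w - v) \<le> 1 / p * norm w powr p - 1 / p * norm v powr p"
proof (cases "v = 0")
  case False
  then have v: "norm v > 0" by simp
  have q1: "q > 1" "(p - 1) * q = p"
  proof -
    have "0 < 1 / p" "1 / p < 1" using p by simp_all
    then have "0 < 1 / q" "1 / q < 1" unfolding q by simp_all
    then show "q > 1" by (simp add: divide_less_eq_1)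
    then show "(p - 1) * q = p" using p q by (simp add: field_simps)
  qed
  have vv: "norm v powr (p - 2) * (norm v * norm v) = norm v powr p"
    "norm v powr (p - 2) * norm v = norm v powr (p - 1)"
  proof -
    have "norm v powr p = norm v powr ((p - 2) + 1 + 1)" by simp
    then show "norm v powr (p - 2) * (norm v * norm v) = norm v powr p" using v by (simp only: powr_add) simp
    have "norm v powr (p - 1) = norm v powr ((p - 2) + 1)" by simp
    then show "norm v powr (p - 2) * norm v = norm v powr (p - 1)" using v by (simp only: powr_add) simp
  qed
  have "norm v powr (p - 2) * (v \<bullet> w) \<le> norm v powr (p - 2) * (norm v * norm w)"
    by (intro mult_left_mono norm_cauchy_schwarz) simp
  also have "\<dots> = norm w * norm v powr (p - 1)" by (simp flip: vv(2))
  also have "\<dots> \<le> norm w powr p / p + (norm v powr (p - 1)) powr q / q"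
    by (rule Youngs_inequality) (use p q q1 in auto)
  also have "(norm v powr (p - 1)) powr q = norm v powr p" by (simp add: powr_powr q1)
  finally have "norm v powr (p - 2) * (v \<bullet> w) \<le> norm w powr p / p + norm v powr p * (1 / q)" by simp
  moreover have "norm v powr (p - 2) * (v \<bullet> v) = norm v powr p"
    using vv(1) by (simp add: dot_square_norm power2_eq_square)
  ultimately show ?thesis
    by (simp add: q inner_diff_right right_diff_distrib)
qed (use p in simp)

lemma continuous_power_gradient:
  assumes p: "1 < p"
  shows "continuous_on UNIV (\<lambda>v :: 'a::real_inner. norm v powr (p - 2) *\<^sub>R v)"
  unfolding continuous_on_def
proof
  fix v :: 'a
  show "((\<lambda>v. norm v powr (p - 2) *\<^sub>R v) \<longlongrightarrow> norm v powr (p - 2) *\<^sub>R v) (at v within UNIV)"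
  proof (cases "v = 0")
    case False
    then show ?thesis by (intro tendsto_intros) simp
  next
    case True
    have eq: "norm (norm w powr (p - 2) *\<^sub>R w) = norm w powr (p - 1)" for w :: 'a
    proof (cases "w = 0")
      case False
      have "norm w powr (p - 1) = norm w powr ((p - 2) + 1)" by simp
      then show ?thesis using False by (simp only: powr_add) simp
    qed (use p in simp)
    have "((\<lambda>w :: 'a. norm w powr (p - 1)) \<longlongrightarrow> norm (0 :: 'a) powr (p - 1)) (at 0)"
      by (rule tendsto_powr'[OF tendsto_norm[OF tendsto_ident_at] tendsto_const]) (use p in auto)
    then have "((\<lambda>w :: 'a. norm (norm w powr (p - 2) *\<^sub>R w)) \<longlongrightarrow> 0) (at 0)"
      using p by (simp only: eq) simp
    then have "((\<lambda>w :: 'a. norm w powr (p - 2) *\<^sub>R w) \<longlongrightarrow> 0) (at 0)"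
      by (rule tendsto_norm_zero_cancel)
    then show ?thesis using True by simp
  qed
qed

theorem theorem3:
  fixes X Y :: "(real ^ 'n) set"
    and \<mu> \<nu> :: "(real ^ 'n) measure"
    and c :: "real ^ 'n \<Rightarrow> real ^ 'n \<Rightarrow> real"
  assumes "compact X" and "compact Y"
    and "borel_prob_on X \<mu>" and "borel_prob_on Y \<nu>"
    and "absolutely_continuous (restrict_space lborel X) \<mu>"
    and "absolutely_continuous (restrict_space lborel Y) \<nu>"
    and "lsc_on (X \<times> Y) (\<lambda>(x, y). c x y)"
  shows
    \<comment> \<open>(i)\<close>
    "((SUP \<psi>\<in>{\<psi>. continuous_on Y \<psi>}. INF t\<in>measurable \<mu> \<nu>. F_fun c \<mu> \<nu> \<psi> t)
        = (SUP \<psi>\<in>{\<psi>. continuous_on Y \<psi>}. dual_fun c Y \<mu> \<nu> \<psi>)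
      \<and> (SUP \<psi>\<in>{\<psi>. continuous_on Y \<psi>}. dual_fun c Y \<mu> \<nu> \<psi>) = kantorovich_dual c X Y \<mu> \<nu>)
    \<and> \<comment> \<open>(ii)\<close>
    (\<forall>\<psi>. continuous_on Y \<psi> \<longrightarrow>
      (let \<psi>' = (\<lambda>y. ereal (\<psi> y));
           \<psi>cc = cc_trans c X Y \<psi>';
           m = (INF t\<in>measurable \<mu> \<nu>. F_fun c \<mu> \<nu> \<psi> t);
           mcc = (INF t\<in>measurable \<mu> \<nu>. F_fun_ext c \<mu> \<nu> \<psi>cc t)
       in m \<le> mcc
        \<and> (c_concave_on_Y c X Y \<psi>' \<longrightarrow> m = mcc)
        \<and> (m = mcc \<and> m < \<infinity> \<longrightarrow>
             c_concave_on_Y c X Y \<psi>cc \<and> (AE y in \<nu>. \<psi>' y = \<psi>cc y))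
        \<and> (continuous_on (X \<times> Y) (\<lambda>(x, y). c x y)
             \<and> (\<forall>U. open U \<and> U \<inter> Y \<noteq> {} \<longrightarrow> emeasure \<nu> (U \<inter> Y) > 0) \<longrightarrow>
             m = mcc \<longrightarrow> c_concave_on_Y c X Y \<psi>')))
    \<and> \<comment> \<open>(iii)\<close>
    (\<forall>t\<in>measurable \<mu> \<nu>. distr \<mu> \<nu> t \<noteq> \<nu> \<longrightarrow>
      (SUP \<psi>\<in>{\<psi>. continuous_on Y \<psi>}. F_fun c \<mu> \<nu> \<psi> t) = \<infinity>)
    \<and>
    (\<forall>p q :: real. 1 < p \<and> 1 / q = 1 - 1 / p
        \<and> (\<forall>x\<in>X. \<forall>y\<in>Y. c x y = 1 / p * norm (x - y) powr p) \<longrightarrow>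
      \<comment> \<open>(iv)\<close>
      (\<exists>\<psi>s Ts. saddle_pair c Y \<mu> \<nu> \<psi>s Ts)
      \<and> (\<forall>\<psi>s Ts. saddle_pair c Y \<mu> \<nu> \<psi>s Ts \<longrightarrow>
          (AE x in \<mu>. {y. is_arg_min (\<lambda>y. c x y - \<psi>s y) (\<lambda>y. y \<in> Y) y} = {Ts x})
          \<and> optimal_transport_map c \<mu> \<nu> Ts
          \<and> (\<forall>T. optimal_transport_map c \<mu> \<nu> T \<longrightarrow> (AE x in \<mu>. T x = Ts x))
          \<and> (AE x in \<mu>. \<exists>g.
               has_gradient_within
                 (\<lambda>x. real_of_ereal (ctrans_Y c Y (\<lambda>y. ereal (\<psi>s y)) x)) g X x
               \<and> Ts x = x - norm g powr (q - 2) *\<^sub>R g)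
          \<comment> \<open>(v)\<close>
          \<and> (\<forall>\<psi>1 T1. saddle_pair c Y \<mu> \<nu> \<psi>1 T1 \<longrightarrow> (AE x in \<mu>. T1 x = Ts x))
          \<and> (\<forall>t\<in>measurable \<mu> \<nu>.
               (\<forall>s\<in>measurable \<mu> \<nu>. F_fun c \<mu> \<nu> \<psi>s t \<le> F_fun c \<mu> \<nu> \<psi>s s)
               \<longleftrightarrow> (AE x in \<mu>. t x = Ts x))))"
proof -
  interpret transport X Y \<mu> \<nu> c
    by standard (fact assms)+
  have ii: "let \<psi>' = (\<lambda>y. ereal (\<psi> y));
           \<psi>cc = cc_trans c X Y \<psi>';
           m = (INF t\<in>measurable \<mu> \<nu>. F_fun c \<mu> \<nu> \<psi> t);
           mcc = (INF t\<in>measurable \<mu> \<nu>. F_fun_ext c \<mu> \<nu> \<psi>cc t)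
       in m \<le> mcc
        \<and> (c_concave_on_Y c X Y \<psi>' \<longrightarrow> m = mcc)
        \<and> (m = mcc \<and> m < \<infinity> \<longrightarrow>
             c_concave_on_Y c X Y \<psi>cc \<and> (AE y in \<nu>. \<psi>' y = \<psi>cc y))
        \<and> (continuous_on (X \<times> Y) (\<lambda>(x, y). c x y)
             \<and> (\<forall>U. open U \<and> U \<inter> Y \<noteq> {} \<longrightarrow> emeasure \<nu> (U \<inter> Y) > 0) \<longrightarrow>
             m = mcc \<longrightarrow> c_concave_on_Y c X Y \<psi>')" if \<psi>: "continuous_on Y \<psi>" for \<psi>
    unfolding Let_def
  proof (intro conjI impI)
    show "(INF t\<in>measurable \<mu> \<nu>. F_fun c \<mu> \<nu> \<psi> t)
        \<le> (INF t\<in>measurable \<mu> \<nu>. F_fun_ext c \<mu> \<nu> (cc_trans c X Y (\<lambda>y. ereal (\<psi> y))) t)"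
      by (rule INF_F_fun_le_cc[OF \<psi>])
    show "(INF t\<in>measurable \<mu> \<nu>. F_fun c \<mu> \<nu> \<psi> t)
        = (INF t\<in>measurable \<mu> \<nu>. F_fun_ext c \<mu> \<nu> (cc_trans c X Y (\<lambda>y. ereal (\<psi> y))) t)"
      if "c_concave_on_Y c X Y (\<lambda>y. ereal (\<psi> y))"
      by (rule INF_F_fun_eq_cc_if_c_concave[OF \<psi> that])
    show "c_concave_on_Y c X Y (cc_trans c X Y (\<lambda>y. ereal (\<psi> y)))"
      by (auto simp: c_concave_on_Y_def cc_trans_def)
    show "AE y in \<nu>. ereal (\<psi> y) = cc_trans c X Y (\<lambda>y. ereal (\<psi> y)) y"
      if "(INF t\<in>measurable \<mu> \<nu>. F_fun c \<mu> \<nu> \<psi> t)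
        = (INF t\<in>measurable \<mu> \<nu>. F_fun_ext c \<mu> \<nu> (cc_trans c X Y (\<lambda>y. ereal (\<psi> y))) t)
        \<and> (INF t\<in>measurable \<mu> \<nu>. F_fun c \<mu> \<nu> \<psi> t) < \<infinity>"
      using AE_eq_cc_if_INF_F_fun_eq[OF \<psi> conjunct1[OF that] conjunct2[OF that]] AE_space
      by eventually_elim (simp add: space_\<nu> cc_trans_eq_cctr[OF \<psi>])
    show "c_concave_on_Y c X Y (\<lambda>y. ereal (\<psi> y))"
      if c: "continuous_on (X \<times> Y) (\<lambda>(x, y). c x y)
          \<and> (\<forall>U. open U \<and> U \<inter> Y \<noteq> {} \<longrightarrow> emeasure \<nu> (U \<inter> Y) > 0)"
        and eq: "(INF t\<in>measurable \<mu> \<nu>. F_fun c \<mu> \<nu> \<psi> t)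
        = (INF t\<in>measurable \<mu> \<nu>. F_fun_ext c \<mu> \<nu> (cc_trans c X Y (\<lambda>y. ereal (\<psi> y))) t)"
    proof -
      interpret continuous_transport X Y \<mu> \<nu> c
        by standard (use c in blast)
      show ?thesis by (rule c_concave_if_INF_F_fun_eq[OF \<psi> _ eq]) (use c in blast)
    qed
  qed
  have iv: "(\<exists>\<psi>s Ts. saddle_pair c Y \<mu> \<nu> \<psi>s Ts)
      \<and> (\<forall>\<psi>s Ts. saddle_pair c Y \<mu> \<nu> \<psi>s Ts \<longrightarrow>
          (AE x in \<mu>. {y. is_arg_min (\<lambda>y. c x y - \<psi>s y) (\<lambda>y. y \<in> Y) y} = {Ts x})
          \<and> optimal_transport_map c \<mu> \<nu> Ts
          \<and> (\<forall>T. optimal_transport_map c \<mu> \<nu> T \<longrightarrow> (AE x in \<mu>. T x = Ts x))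
          \<and> (AE x in \<mu>. \<exists>g.
               has_gradient_within
                 (\<lambda>x. real_of_ereal (ctrans_Y c Y (\<lambda>y. ereal (\<psi>s y)) x)) g X x
               \<and> Ts x = x - norm g powr (q - 2) *\<^sub>R g)
          \<and> (\<forall>\<psi>1 T1. saddle_pair c Y \<mu> \<nu> \<psi>1 T1 \<longrightarrow> (AE x in \<mu>. T1 x = Ts x))
          \<and> (\<forall>t\<in>measurable \<mu> \<nu>.
               (\<forall>s\<in>measurable \<mu> \<nu>. F_fun c \<mu> \<nu> \<psi>s t \<le> F_fun c \<mu> \<nu> \<psi>s s)
               \<longleftrightarrow> (AE x in \<mu>. t x = Ts x)))"
    if pq: "1 < p \<and> 1 / q = 1 - 1 / p \<and> (\<forall>x\<in>X. \<forall>y\<in>Y. c x y = 1 / p * norm (x - y) powr p)" for p q :: real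
  proof -
    have p: "1 < p" and q: "1 / q = 1 - 1 / p" using pq by auto
    define h where "h = (\<lambda>v :: real ^ 'n. 1 / p * norm v powr p)"
    define G where "G = (\<lambda>v :: real ^ 'n. norm v powr (p - 2) *\<^sub>R v)"
    have G_inverse: "norm (G v) powr (q - 2) *\<^sub>R G v = v" for v
      unfolding G_def by (rule power_gradient_inverse[OF p q])
    interpret convex_transport X Y \<mu> \<nu> c h G
    proof
      show "c x y = h (x - y)" if "x \<in> X" "y \<in> Y" for x y using pq that by (simp add: h_def)
      show "G v \<bullet> (w - v) \<le> h w - h v" for v w
        unfolding h_def G_def by (rule power_subgradient[OF p q])
      show "continuous_on UNIV G" unfolding G_def by (rule continuous_power_gradient[OF p])
      show "inj G" by (rule inj_on_inverseI[of _ "\<lambda>g. norm g powr (q - 2) *\<^sub>R g"]) (rule G_inverse)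
      show "absolutely_continuous (restrict_space lborel X) \<mu>" by (fact assms)
    qed
    have "AE x in \<mu>. \<exists>g. has_gradient_within
                 (\<lambda>x. real_of_ereal (ctrans_Y c Y (\<lambda>y. ereal (\<psi> y)) x)) g X x
               \<and> T x = x - norm g powr (q - 2) *\<^sub>R g" if "saddle_pair c Y \<mu> \<nu> \<psi> T" for \<psi> T
      using saddle_gradient[OF that]
    proof eventually_elim
      case (elim x)
      then show ?case by (intro exI[of _ "G (x - T x)"]) (simp add: G_inverse)
    qed
    then show ?thesis
      using saddle_pair_exists saddle_arg_min saddle_pair_optimal_transport_map optimal_transport_map_unique
        F_fun_minimizer_iff
      by (intro conjI allI impI ballI) simp_all
  qed
  show ?thesis
  proof (intro conjI allI ballI impI, goal_cases)
    case 1
    show ?case by (intro SUP_cong refl) (simp add: INF_F_fun_eq_dual_fun)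
  next
    case 2
    show ?case by (rule SUP_dual_fun_eq_kantorovich_dual)
  next
    case 3
    then show ?case by (rule ii)
  next
    case 4
    then show ?case by (rule SUP_F_fun_eq_infinity)
  qed (insert iv, blast+)
qed

end
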